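(* Let $G=A\ast_C B$ be an amalgamated free product, where $C$ is an infinite cyclic subgroup with $C\neq A$ and $C\neq B$. Suppose that (1) $G$ has the unique root property; (2) the quotient $A/C^A$ admits a surjective homomorphism onto $\mathbb{Z}$, where $C^A$ denotes the normal closure of $C$ in $A$; (3) if $B$ is abelian, then $B$ admits a surjective homomorphism onto $\mathbb{Z}$. Then the abstract commensurator $\mathrm{Comm}(G)$ is not finitely generated.
   Context: A group has the unique root property if for all $x,y$ in it and every positive integer $n$, $x^n=y^n$ implies $x=y$. The abstract commensurator $\mathrm{Comm}(G)$ of a group $G$ is the group of equivalence classes of isomorphisms between finite-index subgroups of $G$, two such isomorphisms being equivalent if they agree on some finite-index subgroup of $G$ on which both are defined; the product of $\alpha:G_1\to G_1'$ and $\beta:G_2\to G_2'$ is $\alpha\beta:\alpha^{-1}(G_1'\cap G_2)\to\beta(G_1'\cap G_2)$. *)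

theory Defs
  imports "HOL-Algebra.Algebra"
begin

text \<open>G is the amalgamated free product of its subgroups A and B over the subgroup C
  (C contained in A and B): G is the pushout of the inclusions of C into A and B.
  Test groups range over groups whose carrier has type 'a list, which is large enough
  to contain a copy of the amalgam of A and B over C.\<close>

definition amalgamated_product ::
  "('a, 'm) monoid_scheme \<Rightarrow> 'a set \<Rightarrow> 'a set \<Rightarrow> 'a set \<Rightarrow> bool" where
  "amalgamated_product G A B C \<longleftrightarrow>
     group G \<and> subgroup A G \<and> subgroup B G \<and> subgroup C G \<and> C \<subseteq> A \<and> C \<subseteq> B \<and>
     (\<forall>(H :: 'a list monoid) f g.
        group H \<and> f \<in> hom (G\<lparr>carrier := A\<rparr>) H \<and> g \<in> hom (G\<lparr>carrier := B\<rparr>) H \<and>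
        (\<forall>c\<in>C. f c = g c) \<longrightarrow>
          (\<exists>h. h \<in> hom G H \<and> (\<forall>a\<in>A. h a = f a) \<and> (\<forall>b\<in>B. h b = g b)) \<and>
          (\<forall>h h'. h \<in> hom G H \<and> (\<forall>a\<in>A. h a = f a) \<and> (\<forall>b\<in>B. h b = g b) \<and>
                  h' \<in> hom G H \<and> (\<forall>a\<in>A. h' a = f a) \<and> (\<forall>b\<in>B. h' b = g b)
                  \<longrightarrow> (\<forall>x\<in>carrier G. h x = h' x)))"

definition unique_roots :: "('a, 'm) monoid_scheme \<Rightarrow> bool" where
  "unique_roots G \<longleftrightarrow>
     (\<forall>x\<in>carrier G. \<forall>y\<in>carrier G. \<forall>n::nat. n > 0 \<longrightarrow>
        x [^]\<^bsub>G\<^esub> n = y [^]\<^bsub>G\<^esub> n \<longrightarrow> x = y)"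

definition normal_closure :: "('a, 'm) monoid_scheme \<Rightarrow> 'a set \<Rightarrow> 'a set" where
  "normal_closure K S =
     generate K {k \<otimes>\<^bsub>K\<^esub> s \<otimes>\<^bsub>K\<^esub> inv\<^bsub>K\<^esub> k | k s. k \<in> carrier K \<and> s \<in> S}"

definition surj_onto_Z :: "('b, 'n) monoid_scheme \<Rightarrow> bool" where
  "surj_onto_Z K \<longleftrightarrow> (\<exists>h. h \<in> hom K integer_group \<and> h ` carrier K = carrier integer_group)"

definition finite_index_subgroup :: "('a, 'm) monoid_scheme \<Rightarrow> 'a set \<Rightarrow> bool" where
  "finite_index_subgroup G H \<longleftrightarrow> subgroup H G \<and> finite (rcosets\<^bsub>G\<^esub> H)"

definition virtual_isos :: "('a, 'm) monoid_scheme \<Rightarrow> ('a set \<times> ('a \<Rightarrow> 'a)) set" where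
  "virtual_isos G = {(H, f). finite_index_subgroup G H \<and>
      (\<exists>H'. finite_index_subgroup G H' \<and> f \<in> iso (G\<lparr>carrier := H\<rparr>) (G\<lparr>carrier := H'\<rparr>))}"

definition comm_equiv :: "('a, 'm) monoid_scheme \<Rightarrow> ('a set \<times> ('a \<Rightarrow> 'a)) rel" where
  "comm_equiv G = {(p, q). p \<in> virtual_isos G \<and> q \<in> virtual_isos G \<and>
      (\<exists>L. finite_index_subgroup G L \<and> L \<subseteq> fst p \<and> L \<subseteq> fst q \<and>
           (\<forall>x\<in>L. snd p x = snd q x))}"

definition vcompose :: "('a set \<times> ('a \<Rightarrow> 'a)) \<Rightarrow> ('a set \<times> ('a \<Rightarrow> 'a)) \<Rightarrow> ('a set \<times> ('a \<Rightarrow> 'a))" where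
  "vcompose p q = ({x \<in> fst p. snd p x \<in> fst q}, snd q \<circ> snd p)"

definition comm_mult :: "('a, 'm) monoid_scheme \<Rightarrow> ('a set \<times> ('a \<Rightarrow> 'a)) set \<Rightarrow> ('a set \<times> ('a \<Rightarrow> 'a)) set \<Rightarrow> ('a set \<times> ('a \<Rightarrow> 'a)) set" where
  "comm_mult G P Q = {r. \<exists>p\<in>P. \<exists>q\<in>Q. (r, vcompose p q) \<in> comm_equiv G}"

definition Comm :: "('a, 'm) monoid_scheme \<Rightarrow> ('a set \<times> ('a \<Rightarrow> 'a)) set monoid" where
  "Comm G = \<lparr> carrier = virtual_isos G // comm_equiv G,
              monoid.mult = comm_mult G,
              one = comm_equiv G `` {(carrier G, id)} \<rparr>"

definition finitely_generated :: "('b, 'n) monoid_scheme \<Rightarrow> bool" where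
  "finitely_generated K \<longleftrightarrow> (\<exists>S. finite S \<and> S \<subseteq> carrier K \<and> generate K S = carrier K)"

end

(*
  Call a class of Comm(G) good for a prime p if it has a representative H -> H' such that every element
  of G has a power with exponent prime to p in H, and another one in H'. The good classes form a
  subgroup, and a class represented on subgroups of index less than p is good. So if Comm(G) is
  finitely generated, all its classes are good for large p.

  On the other side, let N be the kernel of G -> Z/p x Z/k, where A maps to Z/p through A/C^A and B maps
  to Z/k. It is a tree-like product of conjugates of subgroups of A and B, and it has an automorphism
  that is twisted in only one of the p fibres over Z/p. With unique roots, a good representative
  would fix an element of A that carries the twisted fibre to an untwisted one, so it would be the
  identity on both fibres. Hence the class is not good.

  The automorphism is obtained without any structure theory for N, as a coordinate of a homomorphism from
  G to a permutational wreath product of G, which exists by the universal property of the amalgam.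
  The twist is as follows.
  If B is not abelian: conjugation by an element of B that centralises C.
  If B is abelian and C = <c> maps onto Z under some B -> Z: inversion on the kernel of B -> Z.
  If B is abelian and C maps into kZ with k >= 2: conjugation of one of the k copies of A by an element of B.
*)

theory Submission
  imports Defs
begin

section \<open>Cosets, partial preimages and powers relative to a finite-index subgroup\<close>

section \<open>Finite-index subgroups\<close>

context group
begin

lemma inv_mult_cancel_left [simp]:
  "x \<in> carrier G \<Longrightarrow> y \<in> carrier G \<Longrightarrow> inv x \<otimes> (x \<otimes> y) = y"
  by (simp add: m_assoc[symmetric])

lemma mult_inv_cancel_left [simp]:
  "x \<in> carrier G \<Longrightarrow> y \<in> carrier G \<Longrightarrow> x \<otimes> (inv x \<otimes> y) = y"
  by (simp add: m_assoc[symmetric])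

lemma rcoset_eqD:
  assumes "subgroup H G" "x \<in> carrier G" "y \<in> carrier G" "H #> x = H #> y"
  shows "x \<otimes> inv y \<in> H"
proof -
  have "x \<in> H #> y"
    using assms rcos_self by blast
  then obtain h where "h \<in> H" "x = h \<otimes> y"
    unfolding r_coset_def by blast
  then show ?thesis
    using assms(1,3) by (metis inv_solve_right subgroup.mem_carrier m_closed)
qed

lemma rcoset_eqI:
  assumes "subgroup H G" "x \<in> carrier G" "y \<in> carrier G" "x \<otimes> inv y \<in> H"
  shows "H #> x = H #> y"
proof -
  have "x = (x \<otimes> inv y) \<otimes> y"
    using assms by (simp add: m_assoc)
  then have "x \<in> H #> y"
    unfolding r_coset_def using assms(4) by blast
  then show ?thesis
    using assms repr_independence by metis
qed

text \<open>Each value of \<open>\<kappa>\<close> is taken inside a single right coset of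
  \<open>H\<close>, so there are at most as many cosets as values. Every finite index below comes
  from such an invariant, directly or through preimages.\<close>

lemma finite_index_subgroupI:
  assumes H: "subgroup H G" and fin: "finite (\<kappa> ` carrier G)"
    and eq: "\<And>x y. x \<in> carrier G \<Longrightarrow> y \<in> carrier G \<Longrightarrow> \<kappa> x = \<kappa> y \<Longrightarrow> x \<otimes> inv y \<in> H"
  shows "finite_index_subgroup G H"
proof -
  let ?r = "\<lambda>v. H #> (SOME x. x \<in> carrier G \<and> \<kappa> x = v)"
  have "rcosets H \<subseteq> ?r ` \<kappa> ` carrier G"
  proof
    fix R assume "R \<in> rcosets H"
    then obtain x where x: "x \<in> carrier G" "R = H #> x"
      unfolding RCOSETS_def by blast
    define y where "y = (SOME y. y \<in> carrier G \<and> \<kappa> y = \<kappa> x)"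
    have "y \<in> carrier G \<and> \<kappa> y = \<kappa> x"
      unfolding y_def by (rule someI) (use x in simp)
    then have "R = H #> y"
      using x eq rcoset_eqI[OF H] by metis
    then show "R \<in> ?r ` \<kappa> ` carrier G"
      using x(1) unfolding y_def by blast
  qed
  then show ?thesis
    using H fin unfolding finite_index_subgroup_def by (meson finite_imageI finite_subset)
qed

lemma finite_index_cosets:
  assumes "finite_index_subgroup G H"
  shows "finite ((\<lambda>x. H #> x) ` carrier G)"
proof -
  have "(\<lambda>x. H #> x) ` carrier G = rcosets H"
    unfolding RCOSETS_def by blast
  then show ?thesis
    using assms unfolding finite_index_subgroup_def by simp
qed

lemma finite_index_subgroup_imp_subgroup:
  "finite_index_subgroup G H \<Longrightarrow> subgroup H G"
  unfolding finite_index_subgroup_def by blast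

lemma finite_index_subset_carrier:
  "finite_index_subgroup G H \<Longrightarrow> H \<subseteq> carrier G"
  using finite_index_subgroup_imp_subgroup subgroup.subset by blast

lemma finite_index_carrier: "finite_index_subgroup G (carrier G)"
  by (rule finite_index_subgroupI[where \<kappa> = "\<lambda>_. ()"]) (auto simp: subgroup_self)

text \<open>The invariant is the coset \<open>H #> x\<close> together with the coset of
  \<open>K\<close> containing the image of \<open>x \<otimes> inv t\<close>, where \<open>t\<close>
  is a chosen representative of \<open>H #> x\<close>. If both agree for \<open>x\<close> and
  \<open>y\<close>, the representative cancels and \<open>f (x \<otimes> inv y)\<close> lies in
  \<open>K\<close>.\<close>

lemma finite_index_vimage:
  assumes H: "finite_index_subgroup G H" and K: "finite_index_subgroup G K"
    and f: "\<And>x. x \<in> H \<Longrightarrow> f x \<in> carrier G"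
    and f_mult: "\<And>x y. x \<in> H \<Longrightarrow> y \<in> H \<Longrightarrow> f (x \<otimes> y) = f x \<otimes> f y"
  shows "finite_index_subgroup G {x \<in> H. f x \<in> K}"
proof -
  note subH = finite_index_subgroup_imp_subgroup[OF H]
  note subK = finite_index_subgroup_imp_subgroup[OF K]
  have "f \<in> hom (G\<lparr>carrier := H\<rparr>) G"
    using f f_mult by (auto simp: hom_def)
  then interpret f: group_hom "G\<lparr>carrier := H\<rparr>" G f
    by (intro group_hom.intro group_hom_axioms.intro subgroup_imp_group subH) (rule group_axioms)
  have f_one: "f \<one> = \<one>"
    using f.hom_one by simp
  have f_inv: "f (inv x) = inv (f x)" if "x \<in> H" for x
    using f.hom_inv[of x] that subH m_inv_consistent by simp
  let ?L = "{x \<in> H. f x \<in> K}"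
  have sub: "subgroup ?L G"
  proof
    show "?L \<subseteq> carrier G"
      using subgroup.subset[OF subH] by blast
    show "x \<otimes> y \<in> ?L" if "x \<in> ?L" "y \<in> ?L" for x y
      using that f_mult subH subK by (auto intro: subgroup.m_closed)
    show "\<one> \<in> ?L"
      using f_one subH subK by (simp add: subgroup.one_closed)
    show "inv x \<in> ?L" if "x \<in> ?L" for x
      using that f_inv subH subK by (auto intro: subgroup.m_inv_closed)
  qed
  define r where "r R = (SOME y. y \<in> carrier G \<and> H #> y = R)" for R
  have r: "r (H #> x) \<in> carrier G \<and> H #> r (H #> x) = H #> x" if "x \<in> carrier G" for x
    unfolding r_def by (rule someI[of _ x]) (use that in simp)
  have rH: "x \<otimes> inv (r (H #> x)) \<in> H" if "x \<in> carrier G" for x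
    using rcoset_eqD[OF subH that] r[OF that] by simp
  define \<kappa> where "\<kappa> x = (H #> x, K #> f (x \<otimes> inv (r (H #> x))))" for x
  show ?thesis
  proof (rule finite_index_subgroupI[OF sub, where \<kappa> = \<kappa>])
    have "\<kappa> ` carrier G \<subseteq> ((\<lambda>x. H #> x) ` carrier G) \<times> ((\<lambda>x. K #> x) ` carrier G)"
      unfolding \<kappa>_def using rH f by blast
    then show "finite (\<kappa> ` carrier G)"
      using finite_index_cosets[OF H] finite_index_cosets[OF K]
      by (meson finite_SigmaI finite_subset)
    fix x y assume x: "x \<in> carrier G" and y: "y \<in> carrier G" and "\<kappa> x = \<kappa> y"
    then have 1: "H #> x = H #> y"
      and 2: "K #> f (x \<otimes> inv (r (H #> x))) = K #> f (y \<otimes> inv (r (H #> x)))"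
      unfolding \<kappa>_def by auto
    define t where "t = r (H #> x)"
    have t: "t \<in> carrier G" "x \<otimes> inv t \<in> H" "y \<otimes> inv t \<in> H"
      using r[OF x] rH[OF x] rH[OF y] 1 unfolding t_def by auto
    have "x \<otimes> inv y = (x \<otimes> inv t) \<otimes> inv (y \<otimes> inv t)"
      using x y t(1) by (simp add: inv_mult_group m_assoc inv_solve_left)
    moreover have "f ((x \<otimes> inv t) \<otimes> inv (y \<otimes> inv t)) = f (x \<otimes> inv t) \<otimes> inv (f (y \<otimes> inv t))"
      using f_mult f_inv t subH by (simp add: subgroup.m_inv_closed)
    moreover have "f (x \<otimes> inv t) \<otimes> inv (f (y \<otimes> inv t)) \<in> K"
      using rcoset_eqD[OF subK _ _ 2[folded t_def]] f t by simp
    ultimately show "x \<otimes> inv y \<in> ?L"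
      using rcoset_eqD[OF subH x y 1] by simp
  qed
qed

lemma finite_index_Int:
  assumes "finite_index_subgroup G H" "finite_index_subgroup G K"
  shows "finite_index_subgroup G (H \<inter> K)"
  using finite_index_vimage[of H K "\<lambda>x. x"] assms finite_index_subset_carrier[of H]
  by (auto simp: Int_def)

text \<open>The bound does not depend on \<open>x\<close>; this is what later makes all large primes
  good at the same time.\<close>

lemma finite_index_power_bound:
  assumes H: "finite_index_subgroup G H"
  obtains n :: nat where "\<And>x. x \<in> carrier G \<Longrightarrow> \<exists>m. 0 < m \<and> m \<le> n \<and> x [^] m \<in> H"
proof -
  note subH = finite_index_subgroup_imp_subgroup[OF H]
  let ?R = "(\<lambda>x. H #> x) ` carrier G"
  have "\<exists>m. 0 < m \<and> m \<le> card ?R \<and> x [^] m \<in> H" if x: "x \<in> carrier G" for x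
  proof -
    let ?f = "\<lambda>i::nat. H #> x [^] i"
    have "?f ` {0..card ?R} \<subseteq> ?R"
      using x by auto
    then have "card (?f ` {0..card ?R}) \<le> card ?R"
      using finite_index_cosets[OF H] card_mono by blast
    \<comment> \<open>Pigeonhole: starting the exponents at 0 gives one more exponent than there are
      cosets.\<close>
    then have "\<not> inj_on ?f {0..card ?R}"
      using card_image by fastforce
    then obtain i j where ij: "i \<le> card ?R" "j \<le> card ?R" "i < j" "?f i = ?f j"
      unfolding inj_on_def by (metis atLeastAtMost_iff nat_neq_iff)
    have "x [^] j \<otimes> inv (x [^] i) \<in> H"
      by (rule rcoset_eqD[OF subH]) (use ij x in auto)
    moreover have "x [^] j = x [^] (j - i) \<otimes> x [^] i"
      using ij(3) x by (simp add: nat_pow_mult)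
    ultimately have "x [^] (j - i) \<in> H"
      using x by (simp add: m_assoc)
    then show ?thesis
      using ij by (intro exI[of _ "j - i"]) auto
  qed
  then show thesis
    using that by blast
qed

lemma finite_index_power:
  assumes "finite_index_subgroup G H" "x \<in> carrier G"
  obtains m :: nat where "0 < m" "x [^] m \<in> H"
  using finite_index_power_bound[OF assms(1)] assms(2) by metis

section \<open>Calculus of virtual isomorphisms, and the group formed by their classes\<close>

section \<open>The group structure of the abstract commensurator\<close>

lemma virtual_isos_iff:
  "(H, f) \<in> virtual_isos G \<longleftrightarrow>
     finite_index_subgroup G H \<and> finite_index_subgroup G (f ` H) \<and> inj_on f H \<and>
     (\<forall>x\<in>H. \<forall>y\<in>H. f (x \<otimes> y) = f x \<otimes> f y)"
  unfolding virtual_isos_def iso_def hom_def bij_betw_def by auto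

lemma virtual_isoD:
  assumes "(H, f) \<in> virtual_isos G"
  shows "finite_index_subgroup G H" "finite_index_subgroup G (f ` H)" "inj_on f H"
    "\<And>x y. x \<in> H \<Longrightarrow> y \<in> H \<Longrightarrow> f (x \<otimes> y) = f x \<otimes> f y"
    "subgroup H G" "H \<subseteq> carrier G" "\<And>x. x \<in> H \<Longrightarrow> f x \<in> carrier G"
proof -
  show "finite_index_subgroup G H" "finite_index_subgroup G (f ` H)" "inj_on f H"
    "\<And>x y. x \<in> H \<Longrightarrow> y \<in> H \<Longrightarrow> f (x \<otimes> y) = f x \<otimes> f y"
    using assms unfolding virtual_isos_iff by auto
  then show "subgroup H G" "H \<subseteq> carrier G" "\<And>x. x \<in> H \<Longrightarrow> f x \<in> carrier G"
    using finite_index_subgroup_imp_subgroup finite_index_subset_carrier by blast+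
qed

lemma virtual_iso_group_hom:
  assumes "(H, f) \<in> virtual_isos G"
  shows "group_hom (G\<lparr>carrier := H\<rparr>) G f"
  using virtual_isoD[OF assms]
  by (intro group_hom.intro group_hom_axioms.intro subgroup_imp_group group_axioms)
    (auto simp: hom_def)

lemma virtual_iso_inv:
  assumes "(H, f) \<in> virtual_isos G" "x \<in> H"
  shows "f (inv x) = inv (f x)"
  using group_hom.hom_inv[OF virtual_iso_group_hom[OF assms(1)], of x]
    virtual_isoD(5)[OF assms(1)] assms(2) m_inv_consistent by simp

lemma subgroup_nat_pow_closed:
  assumes "subgroup H G" "x \<in> H"
  shows "x [^] (n::nat) \<in> H"
  using assms by (induction n) (auto simp: subgroup.one_closed subgroup.m_closed)

lemma virtual_iso_nat_pow:
  assumes "(H, f) \<in> virtual_isos G" "x \<in> H"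
  shows "f (x [^] (n::nat)) = f x [^] n"
proof (induction n)
  case 0
  then show ?case
    using group_hom.hom_one[OF virtual_iso_group_hom[OF assms(1)]] by simp
next
  case (Suc n)
  then show ?case
    using virtual_isoD(4,5)[OF assms(1)] assms(2) subgroup_nat_pow_closed by simp
qed

text \<open>The image of \<open>L\<close> is the preimage of \<open>L\<close> under the inverse of
  \<open>f\<close>, which is again a homomorphism on a finite-index subgroup.\<close>

lemma finite_index_virtual_iso_image:
  assumes f: "(H, f) \<in> virtual_isos G" and L: "finite_index_subgroup G L" "L \<subseteq> H"
  shows "finite_index_subgroup G (f ` L)"
proof -
  note D = virtual_isoD[OF f]
  let ?g = "inv_into H f"
  have "finite_index_subgroup G {y \<in> f ` H. ?g y \<in> L}"
  proof (rule finite_index_vimage[OF D(2) L(1)])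
    show "?g y \<in> carrier G" if "y \<in> f ` H" for y
      using that D(3,6) by auto
    fix x y assume "x \<in> f ` H" "y \<in> f ` H"
    then obtain a b where ab: "a \<in> H" "x = f a" "b \<in> H" "y = f b"
      by blast
    then have "a \<otimes> b \<in> H" "x \<otimes> y = f (a \<otimes> b)"
      using D(4,5) by (auto simp: subgroup.m_closed)
    then show "?g (x \<otimes> y) = ?g x \<otimes> ?g y"
      using ab D(3) by simp
  qed
  also have "{y \<in> f ` H. ?g y \<in> L} = f ` L"
    using D(3) L(2) by (auto simp: subset_iff)
  finally show ?thesis .
qed

lemma virtual_iso_inverse:
  assumes f: "(H, f) \<in> virtual_isos G"
  shows "(f ` H, inv_into H f) \<in> virtual_isos G"
proof -
  note D = virtual_isoD[OF f]
  have "inv_into H f (x \<otimes> y) = inv_into H f x \<otimes> inv_into H f y" if xy: "x \<in> f ` H" "y \<in> f ` H" for x y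
  proof -
    obtain a b where ab: "a \<in> H" "x = f a" "b \<in> H" "y = f b"
      using xy by blast
    then have "a \<otimes> b \<in> H" "x \<otimes> y = f (a \<otimes> b)"
      using D(4,5) by (auto simp: subgroup.m_closed)
    then show ?thesis
      using ab D(3) by simp
  qed
  moreover have "inv_into H f ` f ` H = H"
    using D(3) by (simp add: inv_into_image_cancel)
  ultimately show ?thesis
    unfolding virtual_isos_iff using D by (auto simp: inj_on_inv_into)
qed

lemma vcompose_virtual_isos:
  assumes "p \<in> virtual_isos G" "q \<in> virtual_isos G"
  shows "vcompose p q \<in> virtual_isos G"
proof -
  obtain H f K g where p: "p = (H, f)" and q: "q = (K, g)"
    by (cases p, cases q)
  note P = virtual_isoD[OF assms(1)[unfolded p]]
  note Q = virtual_isoD[OF assms(2)[unfolded q]]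
  let ?L = "{x \<in> H. f x \<in> K}"
  have "(g \<circ> f) ` ?L = g ` (f ` H \<inter> K)"
    by auto
  moreover have "finite_index_subgroup G (g ` (f ` H \<inter> K))"
    using assms(2) q P(2) Q(1) by (auto intro: finite_index_virtual_iso_image finite_index_Int)
  moreover have "finite_index_subgroup G ?L"
    by (rule finite_index_vimage) (use P Q in auto)
  moreover have "inj_on (g \<circ> f) ?L"
    using P(3) Q(3) unfolding inj_on_def by simp
  ultimately show ?thesis
    unfolding p q vcompose_def using P(4) Q(4) by (auto simp: virtual_isos_iff)
qed

lemma vcompose_assoc: "vcompose (vcompose p q) r = vcompose p (vcompose q r)"
  unfolding vcompose_def by auto

lemma id_virtual_iso: "(carrier G, id) \<in> virtual_isos G"
  unfolding virtual_isos_iff by (simp add: finite_index_carrier)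

lemma vcompose_id_left: "p \<in> virtual_isos G \<Longrightarrow> vcompose (carrier G, id) p = p"
  unfolding vcompose_def using virtual_isoD(6) by (cases p) fastforce

lemma equiv_comm_equiv: "equiv (virtual_isos G) (comm_equiv G)"
proof (rule equivI)
  show "comm_equiv G \<subseteq> virtual_isos G \<times> virtual_isos G"
    unfolding comm_equiv_def by blast
  show "refl_on (virtual_isos G) (comm_equiv G)"
    unfolding refl_on_def comm_equiv_def using virtual_isoD(1) by fastforce
  show "sym (comm_equiv G)"
    unfolding sym_def comm_equiv_def by fastforce
  show "trans (comm_equiv G)"
  proof (rule transI)
    fix p q r assume "(p, q) \<in> comm_equiv G" "(q, r) \<in> comm_equiv G"
    then obtain L M where "finite_index_subgroup G L" "L \<subseteq> fst p" "L \<subseteq> fst q"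
      "\<forall>x\<in>L. snd p x = snd q x" "finite_index_subgroup G M" "M \<subseteq> fst q" "M \<subseteq> fst r"
      "\<forall>x\<in>M. snd q x = snd r x" "p \<in> virtual_isos G" "r \<in> virtual_isos G"
      unfolding comm_equiv_def by blast
    then show "(p, r) \<in> comm_equiv G"
      unfolding comm_equiv_def using finite_index_Int[of L M]
      by (auto intro!: exI[of _ "L \<inter> M"])
  qed
qed

text \<open>The two composites agree on those elements of \<open>L\<close> whose common image lies
  in \<open>M\<close>.\<close>

lemma vcompose_comm_equiv:
  assumes "(p, p') \<in> comm_equiv G" "(q, q') \<in> comm_equiv G"
  shows "(vcompose p q, vcompose p' q') \<in> comm_equiv G"
proof -
  obtain L M where L: "finite_index_subgroup G L" "L \<subseteq> fst p" "L \<subseteq> fst p'"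
      "\<forall>x\<in>L. snd p x = snd p' x"
    and M: "finite_index_subgroup G M" "M \<subseteq> fst q" "M \<subseteq> fst q'"
      "\<forall>x\<in>M. snd q x = snd q' x"
    and viso: "p \<in> virtual_isos G" "p' \<in> virtual_isos G" "q \<in> virtual_isos G" "q' \<in> virtual_isos G"
    using assms unfolding comm_equiv_def by blast
  have "(fst p, snd p) \<in> virtual_isos G"
    using viso(1) by simp
  note P = virtual_isoD[OF this]
  have "finite_index_subgroup G {x \<in> L. snd p x \<in> M}"
    by (rule finite_index_vimage[OF L(1) M(1)]) (use P L(2) in blast)+
  then show ?thesis
    unfolding comm_equiv_def using viso L M vcompose_virtual_isos
    by (auto intro!: exI[of _ "{x \<in> L. snd p x \<in> M}"] simp: vcompose_def subset_iff)
qed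

lemma comm_mult_class:
  assumes "p \<in> virtual_isos G" "q \<in> virtual_isos G"
  shows "comm_mult G (comm_equiv G `` {p}) (comm_equiv G `` {q}) = comm_equiv G `` {vcompose p q}"
    (is "?L = ?R")
proof
  have s: "(y, x) \<in> comm_equiv G" if "(x, y) \<in> comm_equiv G" for x y
    using equiv_comm_equiv that by (meson equivE symE)
  have t: "(x, z) \<in> comm_equiv G" if "(x, y) \<in> comm_equiv G" "(y, z) \<in> comm_equiv G" for x y z
    using equiv_comm_equiv that by (meson equivE transE)
  show "?L \<subseteq> ?R"
    unfolding comm_mult_def using s t vcompose_comm_equiv by blast
  show "?R \<subseteq> ?L"
    unfolding comm_mult_def using s assms equiv_class_self[OF equiv_comm_equiv] by blast
qed

lemma carrier_Comm: "carrier (Comm G) = (\<lambda>p. comm_equiv G `` {p}) ` virtual_isos G"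
  unfolding Comm_def quotient_def by auto

lemma Comm_mult_class:
  assumes "p \<in> virtual_isos G" "q \<in> virtual_isos G"
  shows "comm_equiv G `` {p} \<otimes>\<^bsub>Comm G\<^esub> comm_equiv G `` {q} = comm_equiv G `` {vcompose p q}"
  using comm_mult_class[OF assms] unfolding Comm_def by simp

lemma one_Comm: "\<one>\<^bsub>Comm G\<^esub> = comm_equiv G `` {(carrier G, id)}"
  unfolding Comm_def by simp

text \<open>The left factor acts first in \<open>vcompose\<close>, so the composite is the identity
  on the image of \<open>f\<close>.\<close>

lemma comm_class_inverse:
  assumes f: "(H, f) \<in> virtual_isos G"
  shows "comm_equiv G `` {(f ` H, inv_into H f)} \<otimes>\<^bsub>Comm G\<^esub> comm_equiv G `` {(H, f)} = \<one>\<^bsub>Comm G\<^esub>"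
proof -
  note D = virtual_isoD[OF f] and I = virtual_iso_inverse[OF f]
  have "(vcompose (f ` H, inv_into H f) (H, f), (carrier G, id)) \<in> comm_equiv G"
    unfolding comm_equiv_def
    using vcompose_virtual_isos[OF I f] id_virtual_iso D(2) finite_index_subset_carrier[OF D(2)]
    by (auto intro!: exI[of _ "f ` H"] simp: vcompose_def inv_into_into f_inv_into_f D(3))
  then show ?thesis
    using Comm_mult_class[OF I f] equiv_class_eq[OF equiv_comm_equiv] one_Comm by simp
qed

lemma group_Comm: "group (Comm G)"
proof (rule groupI)
  fix R Y assume "R \<in> carrier (Comm G)" "Y \<in> carrier (Comm G)"
  then show "R \<otimes>\<^bsub>Comm G\<^esub> Y \<in> carrier (Comm G)"
    unfolding carrier_Comm using Comm_mult_class vcompose_virtual_isos by auto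
next
  show "\<one>\<^bsub>Comm G\<^esub> \<in> carrier (Comm G)"
    unfolding carrier_Comm one_Comm using id_virtual_iso by blast
next
  fix R Y Z assume "R \<in> carrier (Comm G)" "Y \<in> carrier (Comm G)" "Z \<in> carrier (Comm G)"
  then show "R \<otimes>\<^bsub>Comm G\<^esub> Y \<otimes>\<^bsub>Comm G\<^esub> Z = R \<otimes>\<^bsub>Comm G\<^esub> (Y \<otimes>\<^bsub>Comm G\<^esub> Z)"
    unfolding carrier_Comm
    by (auto simp: Comm_mult_class vcompose_virtual_isos vcompose_assoc)
next
  fix R assume "R \<in> carrier (Comm G)"
  then show "\<one>\<^bsub>Comm G\<^esub> \<otimes>\<^bsub>Comm G\<^esub> R = R"
    unfolding carrier_Comm one_Comm
    by (auto simp: Comm_mult_class id_virtual_iso vcompose_id_left)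
next
  fix R assume "R \<in> carrier (Comm G)"
  then obtain H f where f: "(H, f) \<in> virtual_isos G" "R = comm_equiv G `` {(H, f)}"
    unfolding carrier_Comm by auto
  then show "\<exists>Y\<in>carrier (Comm G). Y \<otimes>\<^bsub>Comm G\<^esub> R = \<one>\<^bsub>Comm G\<^esub>"
    using comm_class_inverse[OF f(1)] virtual_iso_inverse[OF f(1)] unfolding carrier_Comm by auto
qed

section \<open>Classes good for a prime, and a configuration that prevents goodness\<close>

section \<open>A criterion for infinite generation\<close>

text \<open>The exponent may depend on \<open>x\<close>; only its divisibility by \<open>p\<close>
  is controlled, which behaves well under composition when \<open>p\<close> is prime.\<close>

definition power_absorbing :: "nat \<Rightarrow> 'a set \<Rightarrow> bool" where
  "power_absorbing p H \<longleftrightarrow> (\<forall>x\<in>carrier G. \<exists>m::nat. \<not> p dvd m \<and> x [^] m \<in> H)"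

text \<open>One representative has to qualify, since restricting it further may destroy the
  property. Domain and image are treated alike because inversion exchanges them.\<close>

definition absorbing_classes :: "nat \<Rightarrow> ('a set \<times> ('a \<Rightarrow> 'a)) set set" where
  "absorbing_classes p = {comm_equiv G `` {(H, f)} | H f.
     (H, f) \<in> virtual_isos G \<and> power_absorbing p H \<and> power_absorbing p (f ` H)}"

text \<open>For a product, two exponents are used in succession, and their product stays prime to
  \<open>p\<close> because \<open>p\<close> is prime.\<close>

lemma subgroup_absorbing_classes:
  assumes p: "Factorial_Ring.prime (p::nat)"
  shows "subgroup (absorbing_classes p) (Comm G)"
proof (rule group.subgroupI[OF group_Comm])
  show "absorbing_classes p \<subseteq> carrier (Comm G)"
    unfolding absorbing_classes_def carrier_Comm by auto
next
  have "power_absorbing p (carrier G)"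
    unfolding power_absorbing_def using p
    by (intro ballI exI[of _ 1]) (auto simp: not_prime_unit)
  then have "comm_equiv G `` {(carrier G, id)} \<in> absorbing_classes p"
    unfolding absorbing_classes_def using id_virtual_iso by fastforce
  then show "absorbing_classes p \<noteq> {}"
    by blast
next
  fix P assume "P \<in> absorbing_classes p"
  then obtain H f where f: "(H, f) \<in> virtual_isos G" "P = comm_equiv G `` {(H, f)}"
    and pow: "power_absorbing p H" "power_absorbing p (f ` H)"
    unfolding absorbing_classes_def by blast
  have "inv\<^bsub>Comm G\<^esub> P = comm_equiv G `` {(f ` H, inv_into H f)}"
    using comm_class_inverse[OF f(1)] virtual_iso_inverse[OF f(1)] f
    by (intro group.inv_equality[OF group_Comm]) (auto simp: carrier_Comm)
  moreover have "inv_into H f ` f ` H = H"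
    using virtual_isoD(3)[OF f(1)] by (simp add: inv_into_image_cancel)
  ultimately show "inv\<^bsub>Comm G\<^esub> P \<in> absorbing_classes p"
    unfolding absorbing_classes_def using virtual_iso_inverse[OF f(1)] pow
    by (intro CollectI exI[of _ "f ` H"] exI[of _ "inv_into H f"]) simp
next
  fix P Q assume "P \<in> absorbing_classes p" "Q \<in> absorbing_classes p"
  then obtain H f K g where f: "(H, f) \<in> virtual_isos G" "P = comm_equiv G `` {(H, f)}"
    and g: "(K, g) \<in> virtual_isos G" "Q = comm_equiv G `` {(K, g)}"
    and powf: "power_absorbing p H" "power_absorbing p (f ` H)"
    and powg: "power_absorbing p K" "power_absorbing p (g ` K)"
    unfolding absorbing_classes_def by blast
  note F = virtual_isoD[OF f(1)] and Gg = virtual_isoD[OF g(1)]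
  let ?L = "{x \<in> H. f x \<in> K}"
  have "power_absorbing p ?L"
    unfolding power_absorbing_def
  proof
    fix x assume x: "x \<in> carrier G"
    then obtain m :: nat where m: "\<not> p dvd m" "x [^] m \<in> H"
      using powf unfolding power_absorbing_def by blast
    then obtain l :: nat where l: "\<not> p dvd l" "f (x [^] m) [^] l \<in> K"
      using powg F(7) unfolding power_absorbing_def by blast
    \<comment> \<open>The power \<open>m\<close> enters the domain of \<open>f\<close>; the further
      power \<open>l\<close> then brings the image into the domain of \<open>g\<close>.\<close>
    have "x [^] (m * l) \<in> ?L"
      using m l virtual_iso_nat_pow[OF f(1) m(2), of l] subgroup_nat_pow_closed[OF F(5) m(2), of l]
      by (simp add: nat_pow_pow x)
    then show "\<exists>m. \<not> p dvd m \<and> x [^] m \<in> ?L"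
      using m l p prime_dvd_multD by blast
  qed
  moreover have "power_absorbing p ((g \<circ> f) ` ?L)"
    unfolding power_absorbing_def
  proof
    fix y assume y: "y \<in> carrier G"
    then obtain m :: nat and k where m: "\<not> p dvd m" "y [^] m = g k" "k \<in> K"
      using powg unfolding power_absorbing_def by blast
    then obtain l :: nat where l: "\<not> p dvd l" "k [^] l \<in> f ` H"
      using powf Gg(6) unfolding power_absorbing_def by blast
    have "y [^] (m * l) = g (k [^] l)"
      using m virtual_iso_nat_pow[OF g(1), of k l] by (simp add: nat_pow_pow[symmetric] y)
    moreover have "g (k [^] l) \<in> (g \<circ> f) ` ?L"
      using l subgroup_nat_pow_closed[OF Gg(5) m(3), of l] by auto
    ultimately show "\<exists>m. \<not> p dvd m \<and> y [^] m \<in> (g \<circ> f) ` ?L"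
      using m l p prime_dvd_multD by metis
  qed
  moreover have "(?L, g \<circ> f) \<in> virtual_isos G"
    using vcompose_virtual_isos[OF f(1) g(1)] by (simp add: vcompose_def)
  moreover have "P \<otimes>\<^bsub>Comm G\<^esub> Q = comm_equiv G `` {(?L, g \<circ> f)}"
    using Comm_mult_class[OF f(1) g(1)] f(2) g(2) by (simp add: vcompose_def)
  ultimately show "P \<otimes>\<^bsub>Comm G\<^esub> Q \<in> absorbing_classes p"
    unfolding absorbing_classes_def by blast
qed

text \<open>A positive exponent below \<open>p\<close> is not divisible by \<open>p\<close>.\<close>

lemma finite_index_power_absorbing:
  assumes "finite_index_subgroup G H"
  obtains n :: nat where "\<And>p. n < p \<Longrightarrow> power_absorbing p H"
proof -
  obtain n :: nat where n: "\<And>x. x \<in> carrier G \<Longrightarrow> \<exists>m. 0 < m \<and> m \<le> n \<and> x [^] m \<in> H"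
    using finite_index_power_bound[OF assms] by blast
  have "power_absorbing p H" if "n < p" for p
    unfolding power_absorbing_def using n that
    by (meson dvd_imp_le leD order_le_less_trans)
  then show thesis
    using that by blast
qed

lemma Comm_absorbing:
  assumes "P \<in> carrier (Comm G)"
  shows "\<exists>n. \<forall>p>n. P \<in> absorbing_classes p"
proof -
  obtain H f where f: "(H, f) \<in> virtual_isos G" "P = comm_equiv G `` {(H, f)}"
    using assms unfolding carrier_Comm by auto
  obtain m n where "\<And>p. m < p \<Longrightarrow> power_absorbing p H" "\<And>p. n < p \<Longrightarrow> power_absorbing p (f ` H)"
    using finite_index_power_absorbing virtual_isoD(1,2)[OF f(1)] by metis
  then show ?thesis
    unfolding absorbing_classes_def using f by (intro exI[of _ "max m n"]) auto
qed

text \<open>Each generator is good beyond some threshold. A prime above the finitely many thresholds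
  is good for all generators, hence for the subgroup they generate.\<close>

lemma finitely_generated_Comm_absorbing:
  assumes "finitely_generated (Comm G)"
  obtains p where "Factorial_Ring.prime (p::nat)" "carrier (Comm G) = absorbing_classes p"
proof -
  obtain S where S: "finite S" "S \<subseteq> carrier (Comm G)" "generate (Comm G) S = carrier (Comm G)"
    using assms unfolding finitely_generated_def by blast
  have "\<exists>n. \<forall>P\<in>S. \<forall>p>n. P \<in> absorbing_classes p"
    using S(1,2)
  proof (induction S rule: finite_induct)
    case (insert P S)
    then obtain m where "\<forall>P\<in>S. \<forall>p>m. P \<in> absorbing_classes p"
      by auto
    moreover obtain n where "\<forall>p>n. P \<in> absorbing_classes p"
      using Comm_absorbing insert.prems by blast
    ultimately show ?case
      by (intro exI[of _ "max m n"]) auto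
  qed simp
  then obtain n where n: "\<And>P p. P \<in> S \<Longrightarrow> n < p \<Longrightarrow> P \<in> absorbing_classes p"
    by blast
  obtain p :: nat where p: "Factorial_Ring.prime p" "n < p"
    using bigger_prime by blast
  have "generate (Comm G) S \<subseteq> absorbing_classes p"
    using n p group.generate_subgroup_incl[OF group_Comm _ subgroup_absorbing_classes] by blast
  moreover have "absorbing_classes p \<subseteq> carrier (Comm G)"
    using subgroup_absorbing_classes[OF p(1)] subgroup.subset by blast
  ultimately show thesis
    using that p(1) S(3) by blast
qed

lemma unique_rootsD:
  assumes "unique_roots G" "x \<in> carrier G" "y \<in> carrier G" "0 < n" "x [^] (n::nat) = y [^] n"
  shows "x = y"
  using assms unfolding unique_roots_def by blast

lemma nat_pow_conj:
  assumes "x \<in> carrier G" "y \<in> carrier G"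
  shows "(inv y \<otimes> x \<otimes> y) [^] (n::nat) = inv y \<otimes> x [^] n \<otimes> y"
proof (induction n)
  case (Suc n)
  then show ?case
    using assms by (simp add: m_assoc)
qed (use assms in simp)

text \<open>In the application \<open>N\<close> stabilises a base fibre, \<open>s\<close> permutes
  the fibres cyclically with period \<open>p\<close>, and \<open>\<phi>\<close> twists
  \<open>x\<close> over the base fibre only. Conjugation by a power of \<open>s\<close> with
  exponent prime to \<open>p\<close> carries \<open>x\<close> to an untwisted fibre.\<close>

definition separating_iso :: "nat \<Rightarrow> 'a set \<Rightarrow> ('a \<Rightarrow> 'a) \<Rightarrow> 'a \<Rightarrow> 'a \<Rightarrow> bool" where
  "separating_iso p N \<phi> s x \<longleftrightarrow>
     (N, \<phi>) \<in> virtual_isos G \<and> s \<in> carrier G \<and> x \<in> N \<and> \<phi> x \<noteq> x \<and>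
     (\<forall>m::nat. p dvd m \<longrightarrow> s [^] m \<in> N \<and> \<phi> (s [^] m) = s [^] m) \<and>
     (\<forall>m::nat. \<not> p dvd m \<longrightarrow> inv (s [^] m) \<otimes> x \<otimes> s [^] m \<in> N \<and>
        \<phi> (inv (s [^] m) \<otimes> x \<otimes> s [^] m) = inv (s [^] m) \<otimes> x \<otimes> s [^] m)"

text \<open>A representative of the class of \<open>\<phi>\<close> defined on \<open>s\<^sup>m\<close> with \<open>m\<close> coprime to \<open>p\<close> fixes \<open>s\<^sup>m\<close>, because
  \<open>\<phi>\<close> fixes its \<open>p\<close>-th power and roots are unique. Since \<open>\<phi>\<close> fixes the conjugate of \<open>x\<close> by \<open>s\<^sup>m\<close>,
  it would have to fix \<open>x\<close>.\<close>

lemma Comm_not_finitely_generatedI: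
  assumes roots: "unique_roots G"
    and ex: "\<And>p::nat. Factorial_Ring.prime p \<Longrightarrow> \<exists>N \<phi> s x. separating_iso p N \<phi> s x"
  shows "\<not> finitely_generated (Comm G)"
proof
  assume "finitely_generated (Comm G)"
  then obtain p where p: "Factorial_Ring.prime (p::nat)" and abs: "carrier (Comm G) = absorbing_classes p"
    using finitely_generated_Comm_absorbing by blast
  obtain N \<phi> s x where "separating_iso p N \<phi> s x"
    using ex[OF p] by blast
  then have \<phi>: "(N, \<phi>) \<in> virtual_isos G" and s: "s \<in> carrier G"
    and x: "x \<in> N" "\<phi> x \<noteq> x"
    and s_fix: "\<And>m::nat. p dvd m \<Longrightarrow> s [^] m \<in> N \<and> \<phi> (s [^] m) = s [^] m"
    and conj_fix: "\<And>m::nat. \<not> p dvd m \<Longrightarrow> inv (s [^] m) \<otimes> x \<otimes> s [^] m \<in> N \<and>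
         \<phi> (inv (s [^] m) \<otimes> x \<otimes> s [^] m) = inv (s [^] m) \<otimes> x \<otimes> s [^] m"
    unfolding separating_iso_def by auto
  note N = virtual_isoD[OF \<phi>]
  have "comm_equiv G `` {(N, \<phi>)} \<in> absorbing_classes p"
    using abs \<phi> unfolding carrier_Comm by blast
  then obtain H f where eq: "comm_equiv G `` {(N, \<phi>)} = comm_equiv G `` {(H, f)}"
    and f: "(H, f) \<in> virtual_isos G" and pow: "power_absorbing p H"
    unfolding absorbing_classes_def by blast
  note H = virtual_isoD[OF f]
  have "((N, \<phi>), (H, f)) \<in> comm_equiv G"
    using eq \<phi> f eq_equiv_class[OF _ equiv_comm_equiv] by blast
  then obtain L where L: "finite_index_subgroup G L" "L \<subseteq> N" "L \<subseteq> H" "\<And>x. x \<in> L \<Longrightarrow> \<phi> x = f x"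
    unfolding comm_equiv_def by auto
  note subL = finite_index_subgroup_imp_subgroup[OF L(1)]
  obtain m :: nat where m: "\<not> p dvd m" "s [^] m \<in> H"
    using pow s unfolding power_absorbing_def by blast
  define y where "y = s [^] m"
  have y: "y \<in> carrier G" "y \<in> H"
    using s m by (auto simp: y_def)
  have fy: "f y = y"
  proof -
    obtain r :: nat where r: "0 < r" "(y [^] p) [^] r \<in> L"
      using finite_index_power[OF L(1), of "y [^] p"] y by blast
    have yr: "y [^] (p * r) \<in> L"
      using r y by (simp add: nat_pow_pow)
    \<comment> \<open>Written as a power of \<open>s\<close>, the element has an exponent divisible
      by \<open>p\<close>, as \<open>s_fix\<close> requires.\<close>
    have sm: "y [^] (p * r) = s [^] (m * (p * r))"
      using s by (simp add: y_def nat_pow_pow)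
    have "f y [^] (p * r) = f (y [^] (p * r))"
      using virtual_iso_nat_pow[OF f y(2)] by simp
    also have "\<dots> = \<phi> (y [^] (p * r))"
      using L(4)[OF yr] by simp
    also have "\<dots> = y [^] (p * r)"
      using s_fix[of "m * (p * r)"] sm by simp
    finally show ?thesis
      using unique_rootsD[OF roots] H(7) y r(1) p prime_gt_0_nat by (metis nat_0_less_mult_iff)
  qed
  define z where "z = inv y \<otimes> x \<otimes> y"
  have z: "z \<in> N" "\<phi> z = z"
    using conj_fix[OF m(1)] unfolding z_def y_def by auto
  have xc: "x \<in> carrier G"
    using x N by blast
  have zc: "z \<in> carrier G"
    using z N by blast
  obtain r1 where r1: "0 < r1" "x [^] (r1::nat) \<in> L"
    using finite_index_power[OF L(1) xc] by blast
  obtain r2 where r2: "0 < r2" "z [^] (r2::nat) \<in> L"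
    using finite_index_power[OF L(1) zc] by blast
  \<comment> \<open>A common exponent puts \<open>x\<close> and its conjugate \<open>z\<close> into
    \<open>L\<close>, where \<open>\<phi>\<close> and \<open>f\<close> agree; unique roots later
    remove it.\<close>
  define r where "r = r1 * r2"
  have r: "0 < r" "x [^] r \<in> L" "z [^] r \<in> L"
    using r1 r2 subgroup_nat_pow_closed[OF subL r1(2), of r2] subgroup_nat_pow_closed[OF subL r2(2), of r1]
    by (auto simp: r_def nat_pow_pow xc zc mult.commute)
  have xz: "x [^] r = y \<otimes> z [^] r \<otimes> inv y"
    unfolding z_def nat_pow_conj[OF xc y(1)] using xc y by (simp add: m_assoc)
  have inH: "z [^] r \<in> H" "inv y \<in> H" "y \<otimes> z [^] r \<in> H"
    using r L y H(5) by (auto intro: subgroup.m_inv_closed subgroup.m_closed)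
  have "f (x [^] r) = f y \<otimes> f (z [^] r) \<otimes> inv (f y)"
    unfolding xz using H(4) inH y virtual_iso_inv[OF f y(2)] by simp
  also have "f (z [^] r) = z [^] r"
    using L(4)[OF r(3)] virtual_iso_nat_pow[OF \<phi> z(1)] z(2) by simp
  finally have "f (x [^] r) = x [^] r"
    using fy xz by simp
  then have "\<phi> x [^] r = x [^] r"
    using L(4)[OF r(2)] virtual_iso_nat_pow[OF \<phi> x(1)] by simp
  then show False
    using unique_rootsD[OF roots _ xc r(1)] N(7)[OF x(1)] x(2) by blast
qed

end

section \<open>The universal property for arbitrary test groups, and generation by the
  factors\<close>

section \<open>Amalgamated products\<close>

text \<open>The position of a letter, and not a tag, decides whether \<open>f\<close> or
  \<open>g\<close> evaluates it, so plain lists over \<open>'a\<close> can code all words in the two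
  images. An unpaired last letter is dropped.\<close>

fun alternating_product ::
  "('h, 'n) monoid_scheme \<Rightarrow> ('a \<Rightarrow> 'h) \<Rightarrow> ('a \<Rightarrow> 'h) \<Rightarrow> 'a list \<Rightarrow> 'h" where
  "alternating_product H f g (x # y # zs) =
     f x \<otimes>\<^bsub>H\<^esub> g y \<otimes>\<^bsub>H\<^esub> alternating_product H f g zs"
| "alternating_product H f g _ = \<one>\<^bsub>H\<^esub>"

text \<open>Every element of the generated subgroup is the value of an alternating word, so choosing
  a word for each element is an injection into lists.\<close>

lemma inj_generate_two_images:
  fixes G :: "('a, 'm) monoid_scheme" (structure) and H :: "('h, 'n) monoid_scheme"
  assumes G: "group G" and A: "subgroup A G" and B: "subgroup B G" and H: "group H"
    and f: "f \<in> hom (G\<lparr>carrier := A\<rparr>) H" and g: "g \<in> hom (G\<lparr>carrier := B\<rparr>) H"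
  obtains e :: "'h \<Rightarrow> 'a list" where "inj_on e (generate H (f ` A \<union> g ` B))"
proof -
  interpret group G by (rule G)
  interpret H: group H by (rule H)
  interpret f: group_hom "G\<lparr>carrier := A\<rparr>" H f
    by (intro group_hom.intro group_hom_axioms.intro subgroup_imp_group A H f)
  interpret g: group_hom "G\<lparr>carrier := B\<rparr>" H g
    by (intro group_hom.intro group_hom_axioms.intro subgroup_imp_group B H g)
  \<comment> \<open>Words are handled as lists of pairs, so that concatenation gives products; a
    single factor is padded with \<open>\<one>\<close>.\<close>
  define ev where "ev ps = alternating_product H f g (concat (map (\<lambda>(a, b). [a, b]) ps))" for ps
  have ev_simps: "ev [] = \<one>\<^bsub>H\<^esub>" "ev ((a, b) # ps) = f a \<otimes>\<^bsub>H\<^esub> g b \<otimes>\<^bsub>H\<^esub> ev ps" for a b ps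
    by (simp_all add: ev_def)
  have fA: "f a \<in> carrier H" if "a \<in> A" for a
    using f.hom_closed that by simp
  have gB: "g b \<in> carrier H" if "b \<in> B" for b
    using g.hom_closed that by simp
  have ev_closed: "ev ps \<in> carrier H" if "set ps \<subseteq> A \<times> B" for ps
    using that by (induction ps) (auto simp: ev_simps fA gB)
  have ev_append: "ev (ps @ qs) = ev ps \<otimes>\<^bsub>H\<^esub> ev qs" if "set ps \<subseteq> A \<times> B" "set qs \<subseteq> A \<times> B" for ps qs
    using that by (induction ps) (auto simp: ev_simps fA gB ev_closed H.m_assoc)
  have ones: "\<one> \<in> A" "\<one> \<in> B" "f \<one> = \<one>\<^bsub>H\<^esub>" "g \<one> = \<one>\<^bsub>H\<^esub>"
    using A B f.hom_one g.hom_one by (auto simp: subgroup.one_closed)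
  have single: "\<exists>ps. set ps \<subseteq> A \<times> B \<and> u = ev ps" if "u \<in> f ` A \<union> g ` B" for u
    using that
  proof
    assume "u \<in> f ` A"
    then obtain a where "a \<in> A" "u = f a" by blast
    then show ?thesis
      by (intro exI[of _ "[(a, \<one>)]"]) (auto simp: ev_simps ones fA)
  next
    assume "u \<in> g ` B"
    then obtain b where "b \<in> B" "u = g b" by blast
    then show ?thesis
      by (intro exI[of _ "[(\<one>, b)]"]) (auto simp: ev_simps ones gB)
  qed
  have "\<exists>ps. set ps \<subseteq> A \<times> B \<and> u = ev ps" if "u \<in> generate H (f ` A \<union> g ` B)" for u
    using that
  proof (induction rule: generate.induct)
    case one
    show ?case
      by (rule exI[of _ "[]"]) (simp add: ev_simps)
  next
    case (incl u)
    then show ?case by (rule single)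
  next
    case (inv u)
    have "inv\<^bsub>H\<^esub> u \<in> f ` A \<union> g ` B"
      using inv
    proof
      assume "u \<in> f ` A"
      then obtain a where a: "a \<in> A" "u = f a" by blast
      then have "inv\<^bsub>H\<^esub> u = f (inv a)"
        using f.hom_inv[of a] A m_inv_consistent by simp
      then show ?thesis
        using a A by (simp add: subgroup.m_inv_closed)
    next
      assume "u \<in> g ` B"
      then obtain b where b: "b \<in> B" "u = g b" by blast
      then have "inv\<^bsub>H\<^esub> u = g (inv b)"
        using g.hom_inv[of b] B m_inv_consistent by simp
      then show ?thesis
        using b B by (simp add: subgroup.m_inv_closed)
    qed
    then show ?case by (rule single)
  next
    case (eng u v)
    then obtain ps qs where "set ps \<subseteq> A \<times> B" "u = ev ps" "set qs \<subseteq> A \<times> B" "v = ev qs"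
      by blast
    then show ?case
      by (intro exI[of _ "ps @ qs"]) (auto simp: ev_append)
  qed
  then have "generate H (f ` A \<union> g ` B) \<subseteq> range (alternating_product H f g)"
    unfolding ev_def by blast
  then show thesis
    using that inj_on_inv_into by blast
qed

locale amalgam = group G for G :: "('a, 'm) monoid_scheme" (structure) +
  fixes A B C :: "'a set"
  assumes amalg: "amalgamated_product G A B C"
begin

lemma subgroups: "subgroup A G" "subgroup B G" "subgroup C G" "C \<subseteq> A" "C \<subseteq> B"
  using amalg unfolding amalgamated_product_def by - (elim conjE, assumption)+

lemma A_carrier [simp]: "a \<in> A \<Longrightarrow> a \<in> carrier G"
  by (rule subgroup.mem_carrier[OF subgroups(1)])

lemma B_carrier [simp]: "b \<in> B \<Longrightarrow> b \<in> carrier G"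
  by (rule subgroup.mem_carrier[OF subgroups(2)])

lemma list_universal:
  fixes H :: "'a list monoid"
  assumes "group H" "f \<in> hom (G\<lparr>carrier := A\<rparr>) H" "g \<in> hom (G\<lparr>carrier := B\<rparr>) H"
    and "\<And>c. c \<in> C \<Longrightarrow> f c = g c"
  shows "\<exists>h. h \<in> hom G H \<and> (\<forall>a\<in>A. h a = f a) \<and> (\<forall>b\<in>B. h b = g b)"
    and "h \<in> hom G H \<Longrightarrow> \<forall>a\<in>A. h a = f a \<Longrightarrow> \<forall>b\<in>B. h b = g b \<Longrightarrow>
      h' \<in> hom G H \<Longrightarrow> \<forall>a\<in>A. h' a = f a \<Longrightarrow> \<forall>b\<in>B. h' b = g b \<Longrightarrow>
      x \<in> carrier G \<Longrightarrow> h x = h' x"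
proof -
  have *: "(\<exists>h. h \<in> hom G H \<and> (\<forall>a\<in>A. h a = f a) \<and> (\<forall>b\<in>B. h b = g b)) \<and>
    (\<forall>h h'. h \<in> hom G H \<and> (\<forall>a\<in>A. h a = f a) \<and> (\<forall>b\<in>B. h b = g b) \<and>
       h' \<in> hom G H \<and> (\<forall>a\<in>A. h' a = f a) \<and> (\<forall>b\<in>B. h' b = g b)
       \<longrightarrow> (\<forall>x\<in>carrier G. h x = h' x))"
    by (rule amalg[unfolded amalgamated_product_def, THEN conjunct2, THEN conjunct2, THEN conjunct2,
          THEN conjunct2, THEN conjunct2, THEN conjunct2, rule_format]) (use assms in simp)
  show "\<exists>h. h \<in> hom G H \<and> (\<forall>a\<in>A. h a = f a) \<and> (\<forall>b\<in>B. h b = g b)"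
    using * by (rule conjunct1)
  show "h \<in> hom G H \<Longrightarrow> \<forall>a\<in>A. h a = f a \<Longrightarrow> \<forall>b\<in>B. h b = g b \<Longrightarrow>
      h' \<in> hom G H \<Longrightarrow> \<forall>a\<in>A. h' a = f a \<Longrightarrow> \<forall>b\<in>B. h' b = g b \<Longrightarrow>
      x \<in> carrier G \<Longrightarrow> h x = h' x"
    using conjunct2[OF *] by blast
qed

text \<open>The subgroup of the target generated by the two images embeds into the words over \<open>'a\<close>,
  which removes the restriction on the type of the test group.\<close>

lemma universal:
  fixes H :: "('h, 'n) monoid_scheme"
  assumes H: "group H" and f: "f \<in> hom (G\<lparr>carrier := A\<rparr>) H" and g: "g \<in> hom (G\<lparr>carrier := B\<rparr>) H"
    and agree: "\<And>c. c \<in> C \<Longrightarrow> f c = g c"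
  obtains h where "h \<in> hom G H" "\<And>a. a \<in> A \<Longrightarrow> h a = f a" "\<And>b. b \<in> B \<Longrightarrow> h b = g b"
proof -
  let ?U = "generate H (f ` A \<union> g ` B)"
  let ?K = "H\<lparr>carrier := ?U\<rparr>"
  obtain e :: "'h \<Rightarrow> 'a list" where e: "inj_on e ?U"
    using inj_generate_two_images[OF is_group subgroups(1,2) H f g] by blast
  have "f ` A \<union> g ` B \<subseteq> carrier H"
    using f g by (auto simp: hom_def)
  then have U: "subgroup ?U H"
    using H group.generate_is_subgroup by blast
  have K: "group ?K"
    using H U by (simp add: group.subgroup_imp_group)
  let ?I = "image_group e ?K"
  have iso: "e \<in> iso ?K ?I" and I: "group ?I"
    using inj_imp_image_group_iso[of e ?K] group.inj_imp_image_group_is_group[OF K] e by auto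
  have e_hom: "e \<in> hom ?K ?I"
    using iso by (simp add: iso_def)
  have incl: "f a \<in> ?U" "g b \<in> ?U" if "a \<in> A" "b \<in> B" for a b
    using that by (auto intro: generate.incl)
  have "f \<in> hom (G\<lparr>carrier := A\<rparr>) ?K"
    using f incl subgroups(2)[THEN subgroup.one_closed] by (auto simp: hom_def)
  then have ef: "e \<circ> f \<in> hom (G\<lparr>carrier := A\<rparr>) ?I"
    by (rule Group.hom_compose[OF _ e_hom])
  have "g \<in> hom (G\<lparr>carrier := B\<rparr>) ?K"
    using g incl subgroups(1)[THEN subgroup.one_closed] by (auto simp: hom_def)
  then have eg: "e \<circ> g \<in> hom (G\<lparr>carrier := B\<rparr>) ?I"
    by (rule Group.hom_compose[OF _ e_hom])
  obtain h where h: "h \<in> hom G ?I" "\<forall>a\<in>A. h a = (e \<circ> f) a" "\<forall>b\<in>B. h b = (e \<circ> g) b"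
    using list_universal(1)[OF I ef eg] agree by auto
  have "inv_into ?U e \<in> hom ?I ?K"
    using group.iso_set_sym[OF K iso] by (simp add: iso_def)
  then have "inv_into ?U e \<circ> h \<in> hom G ?K"
    by (rule Group.hom_compose[OF h(1)])
  then have "inv_into ?U e \<circ> h \<in> hom G H"
    using subgroup.subset[OF U] by (auto simp: hom_def)
  then show thesis
    using that[of "inv_into ?U e \<circ> h"] h(2,3) e incl subgroups(1,2)[THEN subgroup.one_closed]
    by simp
qed

text \<open>The uniqueness clause is applied in a copy of \<open>G\<close> made of one-letter
  lists.\<close>

lemma hom_unique:
  assumes h: "h \<in> hom G G" "h' \<in> hom G G"
    and eq: "\<And>x. x \<in> A \<union> B \<Longrightarrow> h x = h' x" and x: "x \<in> carrier G"
  shows "h x = h' x"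
proof -
  let ?e = "\<lambda>x. [x]"
  let ?I = "image_group ?e G"
  have inj: "inj_on ?e (carrier G)"
    by (simp add: inj_on_def)
  have iso: "?e \<in> hom G ?I" and I: "group ?I"
    using inj_imp_image_group_iso[OF inj] inj_imp_image_group_is_group[OF inj]
    by (auto simp: iso_def)
  have hom: "?e \<circ> h \<in> hom G ?I" "?e \<circ> h' \<in> hom G ?I"
    using Group.hom_compose[OF h(1) iso] Group.hom_compose[OF h(2) iso] by auto
  have res: "?e \<circ> h \<in> hom (G\<lparr>carrier := S\<rparr>) ?I" if "subgroup S G" for S
    using hom(1) subgroup.subset[OF that] by (auto simp: hom_def)
  have "(?e \<circ> h) x = (?e \<circ> h') x"
    by (rule list_universal(2)[OF I res[OF subgroups(1)] res[OF subgroups(2)] _ hom(1) _ _ hom(2)])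
      (use eq x in auto)
  then show ?thesis
    by simp
qed

text \<open>The inclusions of \<open>A\<close> and \<open>B\<close> into the subgroup they generate
  extend to \<open>r\<close> on all of \<open>G\<close>. Followed by the inclusion into
  \<open>G\<close>, \<open>r\<close> agrees with the identity on both factors, so it is the
  identity.\<close>

lemma generated_by_factors: "generate G (A \<union> B) = carrier G"
proof -
  let ?U = "generate G (A \<union> B)"
  have sub: "subgroup ?U G"
    by (rule generate_is_subgroup) auto
  have "(\<lambda>x. x) \<in> hom (G\<lparr>carrier := A\<rparr>) (G\<lparr>carrier := ?U\<rparr>)"
    "(\<lambda>x. x) \<in> hom (G\<lparr>carrier := B\<rparr>) (G\<lparr>carrier := ?U\<rparr>)"
    by (auto simp: hom_def intro: generate.incl)
  then obtain r where r: "r \<in> hom G (G\<lparr>carrier := ?U\<rparr>)" "\<And>a. a \<in> A \<Longrightarrow> r a = a" "\<And>b. b \<in> B \<Longrightarrow> r b = b"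
    using universal[OF subgroup_imp_group[OF sub], of "\<lambda>x. x" "\<lambda>x. x"] by blast
  have "r \<in> hom G G"
    using r(1) subgroup.subset[OF sub] by (auto simp: hom_def)
  moreover have "(\<lambda>x. x) \<in> hom G G"
    by (auto simp: hom_def)
  ultimately have "r x = x" if "x \<in> carrier G" for x
    using hom_unique[of r "\<lambda>x. x" x] r that by auto
  moreover have "r x \<in> ?U" if "x \<in> carrier G" for x
    using r(1) that by (auto simp: hom_def)
  ultimately show ?thesis
    using subgroup.subset[OF sub] by (auto simp: subset_iff)
qed

text \<open>No case for inverses arises, because each factor is closed under them.\<close>

lemma factors_induct [consumes 1, case_names left right mult]:
  assumes "x \<in> carrier G"
    and "\<And>a. a \<in> A \<Longrightarrow> P a" and "\<And>b. b \<in> B \<Longrightarrow> P b"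
    and "\<And>x y. x \<in> carrier G \<Longrightarrow> y \<in> carrier G \<Longrightarrow> P x \<Longrightarrow> P y \<Longrightarrow> P (x \<otimes> y)"
  shows "P x"
proof -
  have "x \<in> generate G (A \<union> B)"
    using assms(1) generated_by_factors by simp
  then show ?thesis
  proof (induction rule: generate.induct)
    case one
    then show ?case
      using assms(2) subgroups(1) subgroup.one_closed by blast
  next
    case (incl x)
    then show ?case
      using assms(2,3) by blast
  next
    case (inv x)
    then show ?case
      using assms(2,3) subgroups(1,2) subgroup.m_inv_closed by fastforce
  next
    case (eng x y)
    then show ?case
      using assms(4) generated_by_factors by simp
  qed
qed

end

section \<open>Wreath products as targets that encode an action together with a cocycle\<close>

section \<open>Permutational wreath products\<close>

text \<open>Permutations compose from left to right. A homomorphism into this group is therefore a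
  right action \<open>\<sigma>\<close> with maps \<open>F q\<close> satisfying
  \<open>F q (x \<otimes> y) = F q x \<otimes> F (\<sigma> x q) y\<close>.\<close>

definition wreath :: "'q itself \<Rightarrow> ('a, 'm) monoid_scheme \<Rightarrow> (('q \<Rightarrow> 'q) \<times> ('q \<Rightarrow> 'a)) monoid" where
  "wreath _ G = \<lparr>carrier = {(\<sigma>, f). bij \<sigma> \<and> (\<forall>q. f q \<in> carrier G)},
     monoid.mult = (\<lambda>(\<sigma>, f) (\<tau>, g). (\<tau> \<circ> \<sigma>, \<lambda>q. f q \<otimes>\<^bsub>G\<^esub> g (\<sigma> q))),
     one = (id, \<lambda>_. \<one>\<^bsub>G\<^esub>)\<rparr>"

lemma carrier_wreath: "carrier (wreath TYPE('q) G) = {(\<sigma>, f). bij \<sigma> \<and> (\<forall>q. f q \<in> carrier G)}"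
  by (simp add: wreath_def)

lemma mult_wreath [simp]:
  "(\<sigma>, f) \<otimes>\<^bsub>wreath TYPE('q) G\<^esub> (\<tau>, g) = (\<tau> \<circ> \<sigma>, \<lambda>q. f q \<otimes>\<^bsub>G\<^esub> g (\<sigma> q))"
  by (simp add: wreath_def)

lemma (in group) group_wreath: "group (wreath TYPE('q) G)"
proof (rule groupI)
  fix u assume "u \<in> carrier (wreath TYPE('q) G)"
  then obtain \<sigma> :: "'q \<Rightarrow> 'q" and f where u: "u = (\<sigma>, f)" "bij \<sigma>" "\<And>q. f q \<in> carrier G"
    by (auto simp: carrier_wreath)
  let ?v = "(inv_into UNIV \<sigma>, \<lambda>q. inv (f (inv_into UNIV \<sigma> q)))"
  have "?v \<in> carrier (wreath TYPE('q) G)"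
    using u by (auto simp: carrier_wreath bij_imp_bij_inv)
  moreover have "?v \<otimes>\<^bsub>wreath TYPE('q) G\<^esub> u = \<one>\<^bsub>wreath TYPE('q) G\<^esub>"
    using u bij_is_surj[OF u(2)] by (auto simp: wreath_def surj_iff)
  ultimately show "\<exists>v\<in>carrier (wreath TYPE('q) G). v \<otimes>\<^bsub>wreath TYPE('q) G\<^esub> u = \<one>\<^bsub>wreath TYPE('q) G\<^esub>"
    by blast
qed (auto simp: wreath_def bij_comp m_assoc)

section \<open>Cocycles over a finite cyclic cover and the virtual automorphisms they induce\<close>

section \<open>Twisting one fibre of a finite cover\<close>

text \<open>Translation of residues, extended by the identity so that it permutes a type independent
  of \<open>k\<close>.\<close>

definition shift :: "int \<Rightarrow> int \<Rightarrow> int \<Rightarrow> int" where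
  "shift k m j = (if 0 \<le> j \<and> j < k then (j + m) mod k else j)"

lemma shift_shift: "shift k m (shift k n j) = shift k (n + m) j"
  by (auto simp: shift_def mod_simps ac_simps)

lemma shift_cong: "k dvd m - n \<Longrightarrow> shift k m = shift k n"
  by (auto simp: shift_def fun_eq_iff mod_eq_dvd_iff)

lemma shift_0 [simp]: "shift k 0 j = j"
  by (auto simp: shift_def)

lemma shift_dvd: "k dvd m \<Longrightarrow> shift k m j = j"
  using shift_cong[of k m 0] by simp

lemma shift_at_0: "0 < k \<Longrightarrow> shift k m 0 = m mod k"
  by (simp add: shift_def)

lemma shift_range: "j \<in> {0..<k} \<Longrightarrow> shift k m j \<in> {0..<k}"
  by (auto simp: shift_def)

lemma shift_eq_0_iff: "0 < k \<Longrightarrow> shift k m 0 = 0 \<longleftrightarrow> k dvd m"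
  by (auto simp: shift_at_0 mod_eq_0_iff_dvd)

lemma bij_shift_prod: "bij (\<lambda>(i, j). (shift p m i, shift k n j))"
  by (rule bij_betw_byWitness[where f' = "\<lambda>(i, j). (shift p (-m) i, shift k (-n) j)"])
    (auto simp: shift_shift)

text \<open>The group acts on the pairs of integers through \<open>\<int>/p \<times> \<int>/k\<close>: the factor \<open>A\<close> shifts the
  first coordinate by \<open>\<pi>\<close> and \<open>B\<close> shifts the second one by \<open>h\<close>. Pairs outside
  the ranges \<open>[0, p)\<close> and \<open>[0, k)\<close> are fixed.\<close>

locale fibred_amalgam = amalgam +
  fixes \<pi> h :: "'a \<Rightarrow> int" and p k :: int
  assumes \<pi>_mult: "\<And>a a'. a \<in> A \<Longrightarrow> a' \<in> A \<Longrightarrow> \<pi> (a \<otimes> a') = \<pi> a + \<pi> a'"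
    and \<pi>_C: "\<And>c. c \<in> C \<Longrightarrow> \<pi> c = 0"
    and h_mult: "\<And>b b'. b \<in> B \<Longrightarrow> b' \<in> B \<Longrightarrow> h (b \<otimes> b') = h b + h b'"
    and h_C: "\<And>c. c \<in> C \<Longrightarrow> k dvd h c"
    and p_pos: "0 < p" and k_pos: "0 < k"
begin

text \<open>The clauses say in turn that the twist keeps the image in the integers modulo
  \<open>k\<close>, that it is compatible with the shift action, and that on \<open>C\<close> it
  matches the trivial twist used on \<open>A\<close>.\<close>

definition fibre_cocycle :: "(int \<Rightarrow> 'a \<Rightarrow> 'a) \<Rightarrow> bool" where
  "fibre_cocycle E \<longleftrightarrow>
     (\<forall>j. \<forall>b\<in>B. E j b \<in> B \<and> k dvd h (E j b) - h b) \<and>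
     (\<forall>j. \<forall>b\<in>B. \<forall>b'\<in>B. E j (b \<otimes> b') = E j b \<otimes> E (shift k (h b) j) b') \<and>
     (\<forall>j. \<forall>c\<in>C. E j c = c)"

text \<open>The components of a homomorphism into the wreath product, with \<open>E\<close> inserted
  over the first coordinate 0 only.\<close>

definition twist ::
  "(int \<Rightarrow> 'a \<Rightarrow> 'a) \<Rightarrow> ('a \<Rightarrow> int \<times> int \<Rightarrow> int \<times> int) \<Rightarrow> (int \<times> int \<Rightarrow> 'a \<Rightarrow> 'a) \<Rightarrow> bool" where
  "twist E \<sigma> F \<longleftrightarrow>
     (\<forall>x\<in>carrier G. inj (\<sigma> x)) \<and> (\<forall>q. \<forall>x\<in>carrier G. F q x \<in> carrier G) \<and>
     (\<forall>x\<in>carrier G. \<forall>y\<in>carrier G. \<sigma> (x \<otimes> y) = \<sigma> y \<circ> \<sigma> x) \<and>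
     (\<forall>q. \<forall>x\<in>carrier G. \<forall>y\<in>carrier G. F q (x \<otimes> y) = F q x \<otimes> F (\<sigma> x q) y) \<and>
     (\<forall>a\<in>A. \<forall>i j. \<sigma> a (i, j) = (shift p (\<pi> a) i, j) \<and> F (i, j) a = a) \<and>
     (\<forall>b\<in>B. \<forall>i j. \<sigma> b (i, j) = (i, shift k (h b) j) \<and> F (i, j) b = (if i = 0 then E j b else b))"

lemma twist_exists:
  assumes E: "fibre_cocycle E"
  obtains \<sigma> F where "twist E \<sigma> F"
proof -
  let ?W = "wreath TYPE(int \<times> int) G"
  \<comment> \<open>The trivial shift of the unmoved coordinate is written out so that
    \<open>bij_shift_prod\<close> covers both factors.\<close>
  define f :: "'a \<Rightarrow> (int \<times> int \<Rightarrow> int \<times> int) \<times> (int \<times> int \<Rightarrow> 'a)"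
    where "f a = (\<lambda>(i, j). (shift p (\<pi> a) i, shift k 0 j), \<lambda>_. a)" for a
  define g :: "'a \<Rightarrow> (int \<times> int \<Rightarrow> int \<times> int) \<times> (int \<times> int \<Rightarrow> 'a)"
    where "g b = (\<lambda>(i, j). (shift p 0 i, shift k (h b) j), \<lambda>(i, j). if i = 0 then E j b else b)" for b
  have Ec: "E j b \<in> carrier G" if "b \<in> B" for j b
    using E that unfolding fibre_cocycle_def by simp
  have f: "f \<in> hom (G\<lparr>carrier := A\<rparr>) ?W"
    unfolding hom_def f_def carrier_wreath using bij_shift_prod[of p _ k 0]
    by (auto simp: \<pi>_mult shift_shift fun_eq_iff add.commute)
  have g: "g \<in> hom (G\<lparr>carrier := B\<rparr>) ?W"
    unfolding hom_def g_def carrier_wreath using bij_shift_prod[of p 0 k] E Ec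
    by (auto simp: h_mult shift_shift fun_eq_iff add.commute fibre_cocycle_def)
  have fg: "f c = g c" if "c \<in> C" for c
    unfolding f_def g_def using that E \<pi>_C shift_dvd[OF h_C[OF that]]
    by (auto simp: fun_eq_iff fibre_cocycle_def)
  obtain \<Phi> where \<Phi>: "\<Phi> \<in> hom G ?W" "\<And>a. a \<in> A \<Longrightarrow> \<Phi> a = f a" "\<And>b. b \<in> B \<Longrightarrow> \<Phi> b = g b"
    using universal[OF group_wreath f g fg] by blast
  define \<sigma> where "\<sigma> x = fst (\<Phi> x)" for x
  define F where "F q x = snd (\<Phi> x) q" for q x
  have \<Phi>_eq: "\<Phi> x = (\<sigma> x, \<lambda>q. F q x)" for x
    by (simp add: \<sigma>_def F_def)
  have closed: "bij (\<sigma> x)" "F q x \<in> carrier G" if "x \<in> carrier G" for x q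
    using \<Phi>(1) that unfolding hom_def carrier_wreath by (auto simp: \<Phi>_eq Pi_iff simp del: split_paired_All)
  have mult: "\<sigma> (x \<otimes> y) = \<sigma> y \<circ> \<sigma> x \<and> (\<lambda>q. F q (x \<otimes> y)) = (\<lambda>q. F q x \<otimes> F (\<sigma> x q) y)"
    if "x \<in> carrier G" "y \<in> carrier G" for x y
    using \<Phi>(1) that hom_mult[OF \<Phi>(1) that] unfolding \<Phi>_eq by simp
  have "twist E \<sigma> F"
    unfolding twist_def using closed mult \<Phi>(2,3)
    by (auto simp: \<Phi>_eq f_def g_def fun_eq_iff bij_is_inj)
  then show thesis
    by (rule that)
qed

lemma twistD:
  assumes "twist E \<sigma> F"
  shows "\<And>x. x \<in> carrier G \<Longrightarrow> inj (\<sigma> x)"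
    and "\<And>q x. x \<in> carrier G \<Longrightarrow> F q x \<in> carrier G"
    and "\<And>x y q. x \<in> carrier G \<Longrightarrow> y \<in> carrier G \<Longrightarrow> \<sigma> (x \<otimes> y) q = \<sigma> y (\<sigma> x q)"
    and "\<And>x y q. x \<in> carrier G \<Longrightarrow> y \<in> carrier G \<Longrightarrow> F q (x \<otimes> y) = F q x \<otimes> F (\<sigma> x q) y"
    and "\<And>a i j. a \<in> A \<Longrightarrow> \<sigma> a (i, j) = (shift p (\<pi> a) i, j)"
    and "\<And>a q. a \<in> A \<Longrightarrow> F q a = a"
    and "\<And>b i j. b \<in> B \<Longrightarrow> \<sigma> b (i, j) = (i, shift k (h b) j)"
    and "\<And>b i j. b \<in> B \<Longrightarrow> F (i, j) b = (if i = 0 then E j b else b)"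
  using assms unfolding twist_def by auto

text \<open>On the factors the action depends on \<open>\<pi>\<close> and \<open>h\<close> alone,
  not on the cocycle.\<close>

lemma twist_action_unique:
  assumes T: "twist E \<sigma> F" and T': "twist E' \<sigma>' F'" and x: "x \<in> carrier G"
  shows "\<sigma>' x = \<sigma> x"
  using x
proof (induction rule: factors_induct)
  case (left a)
  then show ?case
    using twistD(5)[OF T] twistD(5)[OF T'] by (auto simp: fun_eq_iff)
next
  case (right b)
  then show ?case
    using twistD(7)[OF T] twistD(7)[OF T'] by (auto simp: fun_eq_iff)
next
  case (mult x y)
  then show ?case
    using twistD(3)[OF T] twistD(3)[OF T'] by (intro ext) simp
qed

text \<open>\<open>E\<close> preserves \<open>h\<close> modulo \<open>k\<close>. Consequently
  \<open>F (0, 0)\<close> maps the stabiliser of \<open>(0, 0)\<close> into itself.\<close>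

lemma twist_action_invariant:
  assumes E: "fibre_cocycle E" and T: "twist E \<sigma> F" and x: "x \<in> carrier G"
  shows "\<sigma> (F q x) = \<sigma> x"
  using x
proof (induction arbitrary: q rule: factors_induct)
  case (left a)
  then show ?case
    using twistD(6)[OF T] by simp
next
  case (right b)
  have "E j b \<in> B" "shift k (h (E j b)) = shift k (h b)" for j
    using E right shift_cong unfolding fibre_cocycle_def by auto
  then show ?case
    using right twistD(7,8)[OF T] by (cases q) (auto simp: fun_eq_iff)
next
  case (mult x y)
  show ?case
  proof
    fix r
    have "\<sigma> (F q (x \<otimes> y)) r = \<sigma> (F (\<sigma> x q) y) (\<sigma> (F q x) r)"
      using mult.hyps twistD(2,3,4)[OF T] by simp
    then show "\<sigma> (F q (x \<otimes> y)) r = \<sigma> (x \<otimes> y) r"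
      using mult twistD(3)[OF T] by simp
  qed
qed

text \<open>In a product, \<open>F'\<close> moves to the next fibre by the action of
  \<open>F q x\<close>, which equals that of \<open>x\<close>. It is thus enough that
  \<open>E'\<close> inverts \<open>E\<close> on \<open>B\<close>.\<close>

lemma twist_inverse:
  assumes E: "fibre_cocycle E" and T: "twist E \<sigma> F" and T': "twist E' \<sigma>' F'"
    and inv: "\<And>j b. b \<in> B \<Longrightarrow> E' j (E j b) = b"
    and x: "x \<in> carrier G"
  shows "F' q (F q x) = x"
  using x
proof (induction arbitrary: q rule: factors_induct)
  case (left a)
  then show ?case
    using twistD(6)[OF T] twistD(6)[OF T'] by simp
next
  case (right b)
  have "E j b \<in> B" for j
    using E right unfolding fibre_cocycle_def by auto
  then show ?case
    using right twistD(8)[OF T] twistD(8)[OF T'] inv by (cases q) simp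
next
  case (mult x y)
  have "\<sigma>' (F q x) q = \<sigma> x q"
    using twist_action_unique[OF T T'] twist_action_invariant[OF E T] twistD(2)[OF T] mult.hyps by simp
  then show ?case
    using mult twistD(2,4)[OF T] twistD(4)[OF T'] by simp
qed

lemma twist_stabilizer:
  assumes T: "twist E \<sigma> F"
  defines "N \<equiv> {x \<in> carrier G. \<sigma> x (0, 0) = (0, 0)}"
  shows "finite_index_subgroup G N"
proof (rule finite_index_subgroupI[where \<kappa> = "\<lambda>x. \<sigma> x (0, 0)"])
  note T = twistD[OF T]
  \<comment> \<open>The action of \<open>\<one>\<close> is idempotent and injective, hence
    trivial.\<close>
  have one: "\<sigma> \<one> q = q" for q
  proof -
    have "\<sigma> \<one> (\<sigma> \<one> q) = \<sigma> \<one> q"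
      using T(3)[of \<one> \<one> q] by simp
    then show ?thesis
      using T(1)[of \<one>] by (simp add: inj_eq)
  qed
  have inv: "\<sigma> (inv x) (\<sigma> x q) = q" if "x \<in> carrier G" for x q
    using T(3)[of x "inv x" q] one that by simp
  have diff: "x \<otimes> inv y \<in> N"
    if "x \<in> carrier G" "y \<in> carrier G" "\<sigma> x (0, 0) = \<sigma> y (0, 0)" for x y
    unfolding N_def using that T(3) inv by simp
  show "subgroup N G"
  proof
    show "inv x \<in> N" if "x \<in> N" for x
      using diff[of \<one> x] that one unfolding N_def by auto
  qed (auto simp: N_def T(3) one)
  show "x \<otimes> inv y \<in> N"
    if "x \<in> carrier G" "y \<in> carrier G" "\<sigma> x (0, 0) = \<sigma> y (0, 0)" for x y
    by (rule diff[OF that])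
  let ?Q = "{0..<p} \<times> {0..<k}"
  have "\<forall>q\<in>?Q. \<sigma> x q \<in> ?Q" if "x \<in> carrier G" for x
    using that
  proof (induction rule: factors_induct)
    case (left a)
    then show ?case using T(5) shift_range by fastforce
  next
    case (right b)
    then show ?case using T(7) shift_range by fastforce
  next
    case (mult x y)
    then show ?case using T(3) by metis
  qed
  then have "(\<lambda>x. \<sigma> x (0, 0)) ` carrier G \<subseteq> ?Q"
    using p_pos k_pos by (meson SigmaI atLeastLessThan_iff image_subsetI order_refl)
  then show "finite ((\<lambda>x. \<sigma> x (0, 0)) ` carrier G)"
    by (rule finite_subset) simp
qed

text \<open>On the stabiliser the cocycle law at \<open>(0, 0)\<close> becomes multiplicativity, and
  the twist of the inverse cocycle supplies the inverse map.\<close>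

lemma twist_virtual_iso:
  assumes E: "fibre_cocycle E" "fibre_cocycle E'"
    and inv: "\<And>j b. b \<in> B \<Longrightarrow> E' j (E j b) = b" "\<And>j b. b \<in> B \<Longrightarrow> E j (E' j b) = b"
    and T: "twist E \<sigma> F"
  defines "N \<equiv> {x \<in> carrier G. \<sigma> x (0, 0) = (0, 0)}"
  shows "(N, F (0, 0)) \<in> virtual_isos G"
proof -
  obtain \<sigma>' F' where T': "twist E' \<sigma>' F'"
    using twist_exists[OF E(2)] by blast
  have i: "F' q (F q x) = x" "F q (F' q x) = x" "\<sigma>' x = \<sigma> x" if "x \<in> carrier G" for q x
    using twist_inverse[OF E(1) T T' inv(1) that] twist_inverse[OF E(2) T' T inv(2) that]
      twist_action_unique[OF T T' that] by auto
  have maps: "F (0, 0) x \<in> N" "F' (0, 0) x \<in> N"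
    and 1: "F' (0, 0) (F (0, 0) x) = x" "F (0, 0) (F' (0, 0) x) = x" if "x \<in> N" for x
  proof -
    have x: "x \<in> carrier G" "\<sigma> x (0, 0) = (0, 0)"
      using that unfolding N_def by auto
    have c: "F (0, 0) x \<in> carrier G" "F' (0, 0) x \<in> carrier G"
      using twistD(2)[OF T] twistD(2)[OF T'] x(1) by auto
    have "\<sigma> (F (0, 0) x) = \<sigma> x" "\<sigma> (F' (0, 0) x) = \<sigma> x"
      using twist_action_invariant[OF E(1) T x(1)] twist_action_invariant[OF E(2) T' x(1)] i(3)[OF c(2)]
        i(3)[OF x(1)] by auto
    then show "F (0, 0) x \<in> N" "F' (0, 0) x \<in> N"
      unfolding N_def using x c by auto
    show "F' (0, 0) (F (0, 0) x) = x" "F (0, 0) (F' (0, 0) x) = x"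
      using i(1,2)[OF x(1)] by auto
  qed
  have "F (0, 0) ` N = N"
  proof
    show "F (0, 0) ` N \<subseteq> N"
      using maps(1) by blast
    show "N \<subseteq> F (0, 0) ` N"
      using maps(2) 1(2)[symmetric] by blast
  qed
  moreover have "inj_on (F (0, 0)) N"
    using 1(1) by (rule inj_on_inverseI)
  moreover have "finite_index_subgroup G N"
    unfolding N_def by (rule twist_stabilizer[OF T])
  ultimately show ?thesis
    unfolding virtual_isos_iff using twistD(4)[OF T] by (auto simp: N_def)
qed

lemma \<pi>_nat_pow: "s \<in> A \<Longrightarrow> s [^] (m::nat) \<in> A \<and> \<pi> (s [^] m) = int m * \<pi> s"
proof (induction m)
  case 0
  then show ?case
    using \<pi>_mult[of \<one> \<one>] subgroups(1) subgroup.one_closed by fastforce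
next
  case (Suc m)
  then show ?case
    using subgroups(1) \<pi>_mult by (auto simp: subgroup.m_closed algebra_simps)
qed

lemma \<pi>_inv: "a \<in> A \<Longrightarrow> inv a \<in> A \<and> \<pi> (inv a) = - \<pi> a"
  using \<pi>_mult[of a "inv a"] \<pi>_nat_pow[of a 0] subgroups(1) by (simp add: subgroup.m_inv_closed)

text \<open>Evaluating \<open>F (0, 0)\<close> on
  \<open>inv (s [^] m) \<otimes> x \<otimes> s [^] m\<close> evaluates \<open>x\<close> in the fibre
  \<open>-m\<close> modulo \<open>p\<close>, which is untwisted unless \<open>p\<close> divides
  \<open>m\<close>.\<close>

lemma separating_twist:
  assumes E: "fibre_cocycle E" "fibre_cocycle E'"
    and inv: "\<And>j b. b \<in> B \<Longrightarrow> E' j (E j b) = b" "\<And>j b. b \<in> B \<Longrightarrow> E j (E' j b) = b"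
    and T: "twist E \<sigma> F"
    and s: "s \<in> A" "\<pi> s = 1"
    and x: "x \<in> carrier G" "\<And>i. \<sigma> x (i, 0) = (i, 0)"
    and moved: "F (0, 0) x \<noteq> x" and fixed: "\<And>i. i \<noteq> 0 \<Longrightarrow> F (i, 0) x = x"
  shows "\<exists>N \<phi> s x. separating_iso (nat p) N \<phi> s x"
proof -
  define N where "N = {x \<in> carrier G. \<sigma> x (0, 0) = (0, 0)}"
  note D = twistD[OF T]
  have p: "nat p dvd m \<longleftrightarrow> p dvd int m" for m
    using p_pos by (simp add: nat_dvd_iff)
  have "s [^] m \<in> N \<and> F (0, 0) (s [^] m) = s [^] m" if "nat p dvd m" for m :: nat
    using \<pi>_nat_pow[OF s(1), of m] that s D(5,6) p shift_eq_0_iff[OF p_pos] unfolding N_def by auto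
  moreover have "inv (s [^] m) \<otimes> x \<otimes> s [^] m \<in> N \<and>
      F (0, 0) (inv (s [^] m) \<otimes> x \<otimes> s [^] m) = inv (s [^] m) \<otimes> x \<otimes> s [^] m"
    if m: "\<not> nat p dvd m" for m :: nat
  proof -
    define y where "y = s [^] m"
    have y: "y \<in> A" "inv y \<in> A" "\<pi> y = int m" "\<pi> (inv y) = - int m"
      using \<pi>_nat_pow[OF s(1), of m] \<pi>_inv[of y] s(2) by (auto simp: y_def)
    have 1: "shift p (- int m) 0 \<noteq> 0"
      using m p shift_eq_0_iff[OF p_pos, of "- int m"] by simp
    have "\<sigma> (inv y \<otimes> x \<otimes> y) (0, 0) = (0, 0)"
      using D(3,5) y x by (simp add: shift_shift)
    moreover have "F (0, 0) (inv y \<otimes> x \<otimes> y) = inv y \<otimes> x \<otimes> y"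
      using D(3,4,5,6) y x fixed[OF 1] by simp
    ultimately show ?thesis
      unfolding N_def y_def[symmetric] using x(1) y by simp
  qed
  moreover have "x \<in> N"
    using x unfolding N_def by simp
  ultimately have "separating_iso (nat p) N (F (0, 0)) s x"
    unfolding separating_iso_def using twist_virtual_iso[OF E inv T] s moved
    by (auto simp: N_def)
  then show ?thesis
    by blast
qed

end

section \<open>Homomorphisms to the integers, and commutation under unique roots\<close>

section \<open>Separating twists\<close>

lemma (in group) normal_normal_closure:
  assumes "S \<subseteq> carrier G"
  shows "normal_closure G S \<lhd> G"
  unfolding normal_closure_def
proof (rule normal_generateI)
  show "{k \<otimes> s \<otimes> inv k | k s. k \<in> carrier G \<and> s \<in> S} \<subseteq> carrier G"
    using assms by auto
  fix x g assume "x \<in> {k \<otimes> s \<otimes> inv k | k s. k \<in> carrier G \<and> s \<in> S}" and g: "g \<in> carrier G"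
  then obtain k s where ks: "x = k \<otimes> s \<otimes> inv k" "k \<in> carrier G" "s \<in> S" "s \<in> carrier G"
    using assms by blast
  then have "g \<otimes> x \<otimes> inv g = (g \<otimes> k) \<otimes> s \<otimes> inv (g \<otimes> k)"
    using g by (simp add: m_assoc inv_mult_group)
  then show "g \<otimes> x \<otimes> inv g \<in> {k \<otimes> s \<otimes> inv k | k s. k \<in> carrier G \<and> s \<in> S}"
    using ks g by blast
qed

lemma (in group) hom_vanishing_on_normal_closure:
  assumes S: "S \<subseteq> carrier G" and surj: "surj_onto_Z (G Mod normal_closure G S)"
  obtains \<pi> s where "\<And>x y. x \<in> carrier G \<Longrightarrow> y \<in> carrier G \<Longrightarrow> \<pi> (x \<otimes> y) = \<pi> x + (\<pi> y :: int)"
    "\<And>x. x \<in> S \<Longrightarrow> \<pi> x = 0" "s \<in> carrier G" "\<pi> s = 1"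
proof -
  let ?N = "normal_closure G S"
  interpret N: normal ?N G
    by (rule normal_normal_closure[OF S])
  obtain \<eta> where \<eta>: "\<eta> \<in> hom (G Mod ?N) integer_group" "\<eta> ` carrier (G Mod ?N) = UNIV"
    using surj unfolding surj_onto_Z_def by auto
  have mult: "\<eta> (?N #> (x \<otimes> y)) = \<eta> (?N #> x) + \<eta> (?N #> y)" if "x \<in> carrier G" "y \<in> carrier G" for x y
    using hom_mult[OF \<eta>(1), of "?N #> x" "?N #> y"] that N.rcos_sum
    by (simp add: FactGroup_def RCOSETS_def) blast
  have "\<eta> (?N #> x) = 0" if "x \<in> S" for x
  proof -
    have x: "x \<in> carrier G"
      using that S by blast
    have "x = \<one> \<otimes> x \<otimes> inv \<one>"
      using x by simp
    then have "x \<in> ?N"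
      unfolding normal_closure_def using that by (intro generate.incl) blast
    then have "?N #> x = ?N #> \<one>"
      using N.rcos_const N.subset by simp
    then show ?thesis
      using mult[of \<one> \<one>] by simp
  qed
  moreover have "1 \<in> \<eta> ` carrier (G Mod ?N)"
    using \<eta>(2) by simp
  then obtain s where "s \<in> carrier G" "\<eta> (?N #> s) = 1"
    by (auto simp: FactGroup_def RCOSETS_def)
  ultimately show thesis
    using that[of "\<lambda>x. \<eta> (?N #> x)"] mult by blast
qed

text \<open>The conjugate of \<open>x\<close> by \<open>y\<close> has the same \<open>n\<close>-th
  power as \<open>x\<close>, so it equals \<open>x\<close>.\<close>

lemma (in group) commute_of_nat_pow_commute:
  assumes roots: "unique_roots G" and x: "x \<in> carrier G" and y: "y \<in> carrier G"
    and n: "0 < (n::nat)" and comm: "x [^] n \<otimes> y = y \<otimes> x [^] n"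
  shows "x \<otimes> y = y \<otimes> x"
proof -
  have "(inv y \<otimes> x \<otimes> y) [^] n = x [^] n"
    unfolding nat_pow_conj[OF x y] using x y comm by (simp add: m_assoc)
  then have "inv y \<otimes> x \<otimes> y = x"
    using unique_rootsD[OF roots _ x n] x y by simp
  then have "y \<otimes> (inv y \<otimes> x \<otimes> y) = y \<otimes> x"
    by simp
  then show ?thesis
    using x y by (simp add: m_assoc)
qed

text \<open>In a wreath product of the integers, \<open>s\<close> goes to a function supported at 0
  and \<open>t\<close> to the shift by 1. These do not commute since \<open>k\<close> exceeds
  1.\<close>

lemma (in amalgam) exists_noncommuting_pair:
  fixes \<pi> h :: "'a \<Rightarrow> int"
  assumes \<pi>: "\<And>a a'. a \<in> A \<Longrightarrow> a' \<in> A \<Longrightarrow> \<pi> (a \<otimes> a') = \<pi> a + \<pi> a'" "\<And>c. c \<in> C \<Longrightarrow> \<pi> c = 0"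
    and s: "s \<in> A" "\<pi> s = 1"
    and h: "\<And>b b'. b \<in> B \<Longrightarrow> b' \<in> B \<Longrightarrow> h (b \<otimes> b') = h b + h b'" "\<And>c. c \<in> C \<Longrightarrow> k dvd h c"
    and t: "t \<in> B" "h t = 1" and k: "1 < k"
  shows "s \<otimes> t \<noteq> t \<otimes> s"
proof
  assume comm: "s \<otimes> t = t \<otimes> s"
  let ?W = "wreath TYPE(int) integer_group"
  define f :: "'a \<Rightarrow> (int \<Rightarrow> int) \<times> (int \<Rightarrow> int)" where "f a = (shift k 0, \<lambda>j. if j = 0 then \<pi> a else 0)" for a
  define g :: "'a \<Rightarrow> (int \<Rightarrow> int) \<times> (int \<Rightarrow> int)" where "g b = (shift k (h b), \<lambda>_. 0)" for b
  have bij: "bij (shift k m)" for m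
    by (rule bij_betw_byWitness[where f' = "shift k (-m)"]) (auto simp: shift_shift)
  have W: "group ?W"
    by (rule group.group_wreath) simp
  have f: "f \<in> hom (G\<lparr>carrier := A\<rparr>) ?W"
    unfolding hom_def f_def carrier_wreath using bij[of 0] by (auto simp: \<pi> fun_eq_iff)
  have g: "g \<in> hom (G\<lparr>carrier := B\<rparr>) ?W"
    unfolding hom_def g_def carrier_wreath using bij by (auto simp: h shift_shift fun_eq_iff)
  have fg: "f c = g c" if "c \<in> C" for c
    unfolding f_def g_def using that \<pi>(2) shift_dvd[OF h(2)[OF that]] by (auto simp: fun_eq_iff)
  obtain \<Phi> where \<Phi>: "\<Phi> \<in> hom G ?W" "\<And>a. a \<in> A \<Longrightarrow> \<Phi> a = f a" "\<And>b. b \<in> B \<Longrightarrow> \<Phi> b = g b"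
    using universal[OF W f g fg] by blast
  have "f s \<otimes>\<^bsub>?W\<^esub> g t = g t \<otimes>\<^bsub>?W\<^esub> f s"
    using hom_mult[OF \<Phi>(1)] comm \<Phi>(2,3) s(1) t(1) A_carrier B_carrier by metis
  then have "snd (f s \<otimes>\<^bsub>?W\<^esub> g t) 0 = snd (g t \<otimes>\<^bsub>?W\<^esub> f s) 0"
    by simp
  then show False
    unfolding f_def g_def using s t k by (simp add: shift_at_0)
qed

section \<open>Constructions of separating twists from automorphisms and cocycles of
  \<open>B\<close>\<close>

locale amalgam_over_Z = amalgam +
  fixes \<pi> :: "'a \<Rightarrow> int" and s :: 'a and p :: nat
  assumes \<pi>_mult: "\<And>a a'. a \<in> A \<Longrightarrow> a' \<in> A \<Longrightarrow> \<pi> (a \<otimes> a') = \<pi> a + \<pi> a'"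
    and \<pi>_C: "\<And>c. c \<in> C \<Longrightarrow> \<pi> c = 0"
    and s: "s \<in> A" "\<pi> s = 1"
    and p_pos: "0 < p"
begin

text \<open>This is the cover with \<open>k = 1\<close> and a constant cocycle: \<open>B\<close>
  stabilises every fibre, so \<open>x\<close> itself is moved over 0 and fixed elsewhere.\<close>

lemma separating_fibre_automorphism:
  assumes closed: "\<And>b. b \<in> B \<Longrightarrow> \<theta> b \<in> B" "\<And>b. b \<in> B \<Longrightarrow> \<theta>' b \<in> B"
    and mult: "\<And>b b'. b \<in> B \<Longrightarrow> b' \<in> B \<Longrightarrow> \<theta> (b \<otimes> b') = \<theta> b \<otimes> \<theta> b'"
      "\<And>b b'. b \<in> B \<Longrightarrow> b' \<in> B \<Longrightarrow> \<theta>' (b \<otimes> b') = \<theta>' b \<otimes> \<theta>' b'"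
    and fixC: "\<And>c. c \<in> C \<Longrightarrow> \<theta> c = c" "\<And>c. c \<in> C \<Longrightarrow> \<theta>' c = c"
    and inv: "\<And>b. b \<in> B \<Longrightarrow> \<theta>' (\<theta> b) = b" "\<And>b. b \<in> B \<Longrightarrow> \<theta> (\<theta>' b) = b"
    and x: "x \<in> B" "\<theta> x \<noteq> x"
  shows "\<exists>N \<phi> s x. separating_iso p N \<phi> s x"
proof -
  interpret fibred_amalgam G A B C \<pi> "\<lambda>_. 0" "int p" 1
    by unfold_locales (use \<pi>_mult \<pi>_C p_pos in auto)
  have E: "fibre_cocycle (\<lambda>_. \<theta>)" "fibre_cocycle (\<lambda>_. \<theta>')"
    unfolding fibre_cocycle_def using closed mult fixC by auto
  obtain \<sigma> F where T: "twist (\<lambda>_. \<theta>) \<sigma> F"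
    using twist_exists[OF E(1)] by blast
  have "\<exists>N \<phi> s x. separating_iso (nat (int p)) N \<phi> s x"
    by (rule separating_twist[OF E _ _ T s, where x = x]) (use inv x twistD(7,8)[OF T] in auto)
  then show ?thesis
    by simp
qed

lemma separating_conjugation:
  assumes w: "w \<in> B" "\<And>c. c \<in> C \<Longrightarrow> w \<otimes> c = c \<otimes> w" and x: "x \<in> B" "w \<otimes> x \<noteq> x \<otimes> w"
  shows "\<exists>N \<phi> s x. separating_iso p N \<phi> s x"
proof (rule separating_fibre_automorphism[where \<theta> = "\<lambda>b. w \<otimes> b \<otimes> inv w" and \<theta>' = "\<lambda>b. inv w \<otimes> b \<otimes> w"])
  have w': "inv w \<in> B"
    using w subgroups(2) by (simp add: subgroup.m_inv_closed)
  show "w \<otimes> b \<otimes> inv w \<in> B" "inv w \<otimes> b \<otimes> w \<in> B" if "b \<in> B" for b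
    using that w w' subgroups(2) by (simp_all add: subgroup.m_closed)
  show "w \<otimes> (b \<otimes> b') \<otimes> inv w = w \<otimes> b \<otimes> inv w \<otimes> (w \<otimes> b' \<otimes> inv w)"
    "inv w \<otimes> (b \<otimes> b') \<otimes> w = inv w \<otimes> b \<otimes> w \<otimes> (inv w \<otimes> b' \<otimes> w)" if "b \<in> B" "b' \<in> B" for b b'
    using that w by (simp_all add: m_assoc)
  show "w \<otimes> c \<otimes> inv w = c" "inv w \<otimes> c \<otimes> w = c" if "c \<in> C" for c
    using w(2)[OF that] w(1) that subgroups(5) by (auto simp: m_assoc dest!: subsetD)
      (metis B_carrier inv_mult_cancel_left)
  show "inv w \<otimes> (w \<otimes> b \<otimes> inv w) \<otimes> w = b" "w \<otimes> (inv w \<otimes> b \<otimes> w) \<otimes> inv w = b" if "b \<in> B" for b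
    using that w by (simp_all add: m_assoc)
  show "w \<otimes> x \<otimes> inv w \<noteq> x"
  proof
    assume "w \<otimes> x \<otimes> inv w = x"
    then have "w \<otimes> x \<otimes> inv w \<otimes> w = x \<otimes> w"
      by simp
    then show False
      using x w by (simp add: m_assoc)
  qed
qed (rule x)

text \<open>If \<open>C\<close> is a direct factor of \<open>B\<close>, with projection \<open>b \<mapsto> c\<^sup>h\<^sup>b\<close>, the twisting automorphism of \<open>B\<close>
  is the identity on \<open>C\<close> and the inversion on the complementary factor \<open>ker h\<close>.\<close>

lemma separating_inversion:
  assumes roots: "unique_roots G"
    and comm: "\<And>b b'. b \<in> B \<Longrightarrow> b' \<in> B \<Longrightarrow> b \<otimes> b' = b' \<otimes> b"
    and C: "c \<in> C" "C = generate G {c}" and CB: "C \<noteq> B"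
    and h: "\<And>b b'. b \<in> B \<Longrightarrow> b' \<in> B \<Longrightarrow> h (b \<otimes> b') = h b + (h b' :: int)" "h c = 1"
  shows "\<exists>N \<phi> s x. separating_iso p N \<phi> s x"
proof -
  have cB: "c \<in> B" "c \<in> carrier G"
    using C subgroups(5) B_carrier by auto
  have powC: "c [^] (n::int) \<in> C" for n
    using generate_pow[OF cB(2)] C(2) by blast
  then have powB: "c [^] (n::int) \<in> B" for n
    using subgroups(5) by blast
  have invB: "inv b \<in> B" if "b \<in> B" for b
    using that subgroups(2) by (simp add: subgroup.m_inv_closed)
  have h1: "h \<one> = 0"
    using h(1)[of \<one> \<one>] subgroups(2) by (simp add: subgroup.one_closed)
  have h_inv: "h (inv b) = - h b" if "b \<in> B" for b
    using h(1)[OF that invB[OF that]] h1 that by simp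
  have h_nat: "h (c [^] (n::nat)) = int n" for n
  proof (induction n)
    case (Suc n)
    have "c [^] n \<in> B"
      using subgroup_nat_pow_closed[OF subgroups(2) cB(1)] .
    then show ?case
      using h(1)[of "c [^] n" c] cB h(2) Suc by simp
  qed (simp add: h1)
  have h_pow: "h (c [^] (n::int)) = n" for n
  proof (cases n rule: int_cases2)
    case (nonneg m)
    then show ?thesis
      by (simp add: int_pow_int h_nat)
  next
    case (nonpos m)
    have "c [^] m \<in> B"
      using subgroup_nat_pow_closed[OF subgroups(2) cB(1)] .
    then show ?thesis
      using nonpos by (simp add: int_pow_neg_int cB h_inv h_nat)
  qed
  \<comment> \<open>Writing \<open>b\<close> as \<open>c [^] h b\<close> times an element of the
    kernel of \<open>h\<close>, this map inverts only the kernel part.\<close>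
  define \<theta> where "\<theta> b = inv b \<otimes> c [^] (2 * h b)" for b
  have \<theta>B: "\<theta> b \<in> B" if "b \<in> B" for b
    unfolding \<theta>_def using that invB powB subgroups(2) by (simp add: subgroup.m_closed)
  have h\<theta>: "h (\<theta> b) = h b" if "b \<in> B" for b
    unfolding \<theta>_def using that invB powB by (simp add: h(1) h_inv h_pow)
  obtain x where x: "x \<in> B" "x \<notin> C"
    using CB subgroups(5) by blast
  have mult: "\<theta> (b \<otimes> b') = \<theta> b \<otimes> \<theta> b'" if b: "b \<in> B" "b' \<in> B" for b b'
  proof -
    have "\<theta> (b \<otimes> b') = inv b \<otimes> (inv b' \<otimes> c [^] (2 * h b)) \<otimes> c [^] (2 * h b')"
      unfolding \<theta>_def using comm[OF b] b h(1)[OF b] cB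
      by (simp add: inv_mult_group m_assoc int_pow_mult[symmetric] distrib_left)
    also have "inv b' \<otimes> c [^] (2 * h b) = c [^] (2 * h b) \<otimes> inv b'"
      by (rule comm[OF invB[OF b(2)] powB])
    finally show ?thesis
      unfolding \<theta>_def using b cB by (simp add: m_assoc)
  qed
  have fixC: "\<theta> d = d" if d: "d \<in> C" for d
  proof -
    obtain n :: int where n: "d = c [^] n"
      using d C(2) generate_pow[OF cB(2)] by blast
    have "\<theta> d = c [^] (- n + 2 * n)"
      unfolding \<theta>_def n h_pow using cB by (simp only: int_pow_neg int_pow_mult)
    then show ?thesis
      by (simp add: n)
  qed
  have inv: "\<theta> (\<theta> b) = b" if b: "b \<in> B" for b
  proof -
    have "\<theta> (\<theta> b) = inv (c [^] (2 * h b)) \<otimes> b \<otimes> c [^] (2 * h b)"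
      unfolding \<theta>_def[of "\<theta> b"] h\<theta>[OF b] unfolding \<theta>_def using b cB
      by (simp add: inv_mult_group)
    also have "\<dots> = inv (c [^] (2 * h b)) \<otimes> (c [^] (2 * h b) \<otimes> b)"
      using comm[OF b powB] b cB by (simp add: m_assoc)
    finally show ?thesis
      using b cB by simp
  qed
  \<comment> \<open>A fixed \<open>x\<close> would have the same square as \<open>c [^] h x\<close>,
    and unique roots would place it in \<open>C\<close>.\<close>
  have moved: "\<theta> x \<noteq> x"
  proof
    assume "\<theta> x = x"
    then have "x \<otimes> \<theta> x = x \<otimes> x"
      by simp
    then have "c [^] (2 * h x) = x \<otimes> x"
      unfolding \<theta>_def using x cB by simp
    moreover have "c [^] (2 * h x) = c [^] (h x) \<otimes> c [^] (h x)"
      using int_pow_mult[OF cB(2), of "h x" "h x"] by (simp only: mult_2)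
    ultimately have "(c [^] (h x)) [^] (2::nat) = x [^] (2::nat)"
      using x cB by (simp add: numeral_2_eq_2)
    then have "c [^] (h x) = x"
      using unique_rootsD[OF roots, of "c [^] (h x)" x 2] x cB by simp
    then show False
      using x powC by metis
  qed
  show ?thesis
    by (rule separating_fibre_automorphism[OF \<theta>B \<theta>B mult mult fixC fixC inv inv x(1) moved])
qed

text \<open>The map \<open>u\<close> is supported at \<open>0\<close> modulo \<open>k\<close>, so that only one of the \<open>k\<close> conjugates of \<open>A\<close> by
  powers of \<open>t\<close> is conjugated by \<open>w\<close>. Taking \<open>w\<close> in the kernel of \<open>B \<rightarrow> \<int>/k\<close> keeps the cover invariant.\<close>

lemma separating_partial_conjugation:
  assumes roots: "unique_roots G"
    and comm: "\<And>b b'. b \<in> B \<Longrightarrow> b' \<in> B \<Longrightarrow> b \<otimes> b' = b' \<otimes> b"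
    and h: "\<And>b b'. b \<in> B \<Longrightarrow> b' \<in> B \<Longrightarrow> h (b \<otimes> b') = h b + (h b' :: int)" "\<And>c. c \<in> C \<Longrightarrow> k dvd h c"
    and t: "t \<in> B" "h t = 1" and k: "1 < k"
  shows "\<exists>N \<phi> s x. separating_iso p N \<phi> s x"
proof -
  interpret fibred_amalgam G A B C \<pi> h "int p" k
    by unfold_locales (use \<pi>_mult \<pi>_C p_pos h k in auto)
  define w where "w = t [^] nat k"
  have invB: "inv b \<in> B" if "b \<in> B" for b
    using that subgroups(2) by (simp add: subgroup.m_inv_closed)
  have multB: "b \<otimes> b' \<in> B" if "b \<in> B" "b' \<in> B" for b b'
    using that subgroups(2) by (simp add: subgroup.m_closed)
  have oneB: "\<one> \<in> B"
    using subgroups(2) by (simp add: subgroup.one_closed)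
  have h1: "h \<one> = 0"
    using h(1)[OF oneB oneB] by simp
  have h_inv: "h (inv b) = - h b" if "b \<in> B" for b
    using h(1)[OF that invB[OF that]] h1 that by simp
  have h_nat: "t [^] n \<in> B \<and> h (t [^] n) = int n" for n :: nat
    by (induction n) (use h1 oneB h(1) t multB in auto)
  have w: "w \<in> B" "h w = k"
    using h_nat[of "nat k"] k by (auto simp: w_def)
  \<comment> \<open>The power \<open>p\<close> makes \<open>a\<close> act trivially on the fibres
    while it still fails to commute with \<open>w\<close>.\<close>
  define a where "a = s [^] p"
  have a: "a \<in> A" "\<pi> a = int p"
    using \<pi>_nat_pow[OF s(1), of p] s(2) by (auto simp: a_def)
  have wa: "w \<otimes> a \<noteq> a \<otimes> w"
  proof
    assume "w \<otimes> a = a \<otimes> w"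
    then have "t \<otimes> a = a \<otimes> t"
      using commute_of_nat_pow_commute[OF roots, of t a "nat k"] t(1) a(1) k by (simp add: w_def)
    then have "s \<otimes> t = t \<otimes> s"
      using commute_of_nat_pow_commute[OF roots, of s t p] t(1) s(1) p_pos by (simp add: a_def)
    then show False
      using exists_noncommuting_pair[OF \<pi>_mult \<pi>_C s h t k] by blast
  qed
  define u where "u j = (if j = 0 then w else \<one>)" for j :: int
  have u: "u j \<in> B" "k dvd h (u j)" for j
    using w oneB h1 by (auto simp: u_def)
  \<comment> \<open>Left and right factors form a coboundary, so the cocycle law telescopes; on
    \<open>C\<close> the shift is trivial and commutativity of \<open>B\<close> cancels
    them.\<close>
  define E where "E j b = u j \<otimes> b \<otimes> inv (u (shift k (h b) j))" for j b
  define E' where "E' j b = inv (u j) \<otimes> b \<otimes> u (shift k (h b) j)" for j b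
  have EB: "E j b \<in> B" "E' j b \<in> B" and Eh: "k dvd h (E j b) - h b" "k dvd h (E' j b) - h b"
    if "b \<in> B" for j b
    unfolding E_def E'_def using that u invB multB by (auto simp: h(1) h_inv)
  have Eshift: "shift k (h (E j b)) = shift k (h b)" "shift k (h (E' j b)) = shift k (h b)"
    if "b \<in> B" for j b
    using Eh[OF that] shift_cong by blast+
  have EC: "E j c = c" "E' j c = c" if "c \<in> C" for j c
  proof -
    have c: "c \<in> B"
      using that subgroups(5) by blast
    show "E j c = c" "E' j c = c"
      unfolding E_def E'_def shift_dvd[OF h(2)[OF that]]
      using comm[OF u(1) c, of j] comm[OF invB[OF u(1)] c, of j] u(1)[of j] c by (simp_all add: m_assoc)
  qed
  have Emult: "E j (b \<otimes> b') = E j b \<otimes> E (shift k (h b) j) b'"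
    "E' j (b \<otimes> b') = E' j b \<otimes> E' (shift k (h b) j) b'" if "b \<in> B" "b' \<in> B" for j b b'
    unfolding E_def E'_def using that u(1) by (simp_all add: m_assoc shift_shift h(1))
  have E: "fibre_cocycle E" "fibre_cocycle E'"
    unfolding fibre_cocycle_def using EB Eh EC Emult by auto
  have inv: "E' j (E j b) = b" "E j (E' j b) = b" if "b \<in> B" for j b
    unfolding E'_def[of j "E j b"] E_def[of j "E' j b"] Eshift[OF that]
    unfolding E_def E'_def using that u(1) by (simp_all add: m_assoc)
  obtain \<sigma> F where T: "twist E \<sigma> F"
    using twist_exists[OF E(1)] by blast
  note D = twistD[OF T]
  \<comment> \<open>The letter \<open>t\<close> leaves coordinate 0 and \<open>inv t\<close> returns
    to it, so \<open>F (0, 0)\<close> conjugates \<open>x\<close> by \<open>w\<close>;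
    \<open>a\<close> alone would be fixed.\<close>
  define x where "x = t \<otimes> a \<otimes> inv t"
  have t': "inv t \<in> B" "h (inv t) = -1"
    using t invB h_inv by auto
  have x: "x \<in> carrier G"
    using t a by (simp add: x_def)
  have sh1: "shift k 1 0 = 1"
    using k by (simp add: shift_at_0)
  have sh2: "shift k (-1) 1 = 0"
    using k by (simp add: shift_def)
  have \<sigma>x: "\<sigma> x (i, 0) = (i, 0)" for i
    unfolding x_def using t a t' D(3,5,7) by (simp add: shift_dvd sh1 sh2)
  have Fx: "F (i, 0) x = F (i, 0) t \<otimes> a \<otimes> F (i, 1) (inv t)" for i
    unfolding x_def using t a t' D(3,4,5,6,7) by (simp add: shift_dvd sh1)
  have "\<exists>N \<phi> s x. separating_iso (nat (int p)) N \<phi> s x"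
  proof (rule separating_twist[OF E inv T s x \<sigma>x])
    show "F (i, 0) x = x" if "i \<noteq> 0" for i
      unfolding Fx using that t t' D(8) by (simp add: x_def)
    show "F (0, 0) x \<noteq> x"
    proof
      assume "F (0, 0) x = x"
      then have "w \<otimes> t \<otimes> a \<otimes> (inv t \<otimes> inv w) = t \<otimes> a \<otimes> inv t"
        unfolding Fx D(8)[OF t(1)] D(8)[OF t'(1)] E_def u_def
        using t w t' a by (simp add: sh1 sh2 x_def)
      then have "w \<otimes> t \<otimes> a \<otimes> (inv t \<otimes> inv w) \<otimes> (w \<otimes> t) = t \<otimes> a \<otimes> inv t \<otimes> (t \<otimes> w)"
        using comm[OF w(1) t(1)] by simp
      then have "w \<otimes> t \<otimes> a = t \<otimes> a \<otimes> w"
        using t w a by (simp add: m_assoc)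
      then have "t \<otimes> (w \<otimes> a) = t \<otimes> (a \<otimes> w)"
        using comm[OF w(1) t(1)] t w a by (simp add: m_assoc[symmetric])
      then show False
        using wa t w a by simp
    qed
  qed auto
  then show ?thesis
    by simp
qed

end

section \<open>Choice of the twist according to \<open>B\<close> and the image of \<open>C\<close>
  in the integers\<close>

theorem theorem4p4:
  fixes G :: "('a, 'm) monoid_scheme" and A B C :: "'a set"
  assumes amalg: "amalgamated_product G A B C"
    and C_cyclic: "\<exists>c \<in> carrier G. C = generate G {c}"
    and C_infinite: "infinite C"
    and CA: "C \<noteq> A" and CB: "C \<noteq> B"
    and roots: "unique_roots G"
    and quotZ: "surj_onto_Z (G\<lparr>carrier := A\<rparr> Mod normal_closure (G\<lparr>carrier := A\<rparr>) C)"
    and Babel: "comm_group (G\<lparr>carrier := B\<rparr>) \<longrightarrow> surj_onto_Z (G\<lparr>carrier := B\<rparr>)"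
  shows "\<not> finitely_generated (Comm G)"
proof -
  have G: "group G"
    using amalg unfolding amalgamated_product_def by (rule conjunct1)
  interpret amalgam G A B C
    by (intro amalgam.intro amalgam_axioms.intro G amalg)
  obtain c where c: "c \<in> carrier G" "C = generate G {c}"
    using C_cyclic by blast
  have cC: "c \<in> C"
    unfolding c(2) by (simp add: generate.incl)
  have C_pow: "\<exists>n::int. d = c [^]\<^bsub>G\<^esub> n" if "d \<in> C" for d
    using that generate_pow[OF c(1)] c(2) by blast
  have C_comm: "d \<otimes>\<^bsub>G\<^esub> d' = d' \<otimes>\<^bsub>G\<^esub> d" if d: "d \<in> C" "d' \<in> C" for d d'
  proof -
    obtain m n :: int where "d = c [^]\<^bsub>G\<^esub> m" "d' = c [^]\<^bsub>G\<^esub> n"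
      using C_pow d by blast
    then show ?thesis
      using c(1) by (simp add: int_pow_mult[symmetric] add.commute)
  qed
  interpret A: group "G\<lparr>carrier := A\<rparr>"
    by (rule subgroup_imp_group[OF subgroups(1)])
  have "C \<subseteq> carrier (G\<lparr>carrier := A\<rparr>)"
    using subgroups(4) by simp
  then obtain \<pi> s where "\<And>x y. x \<in> carrier (G\<lparr>carrier := A\<rparr>) \<Longrightarrow> y \<in> carrier (G\<lparr>carrier := A\<rparr>) \<Longrightarrow>
      \<pi> (x \<otimes>\<^bsub>G\<lparr>carrier := A\<rparr>\<^esub> y) = \<pi> x + (\<pi> y :: int)"
    "\<And>x. x \<in> C \<Longrightarrow> \<pi> x = 0" "s \<in> carrier (G\<lparr>carrier := A\<rparr>)" "\<pi> s = 1"
    using A.hom_vanishing_on_normal_closure[OF _ quotZ] by metis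
  then have \<pi>: "\<And>x y. x \<in> A \<Longrightarrow> y \<in> A \<Longrightarrow> \<pi> (x \<otimes>\<^bsub>G\<^esub> y) = \<pi> x + \<pi> y"
    "\<And>x. x \<in> C \<Longrightarrow> \<pi> x = 0" and s: "s \<in> A" "\<pi> s = 1"
    by auto
  show ?thesis
  proof (rule Comm_not_finitely_generatedI[OF roots])
    fix p :: nat assume p: "Factorial_Ring.prime p"
    interpret amalgam_over_Z G A B C \<pi> s p
      by unfold_locales (use \<pi> s p prime_gt_0_nat in auto)
    show "\<exists>N \<phi> s x. separating_iso p N \<phi> s x"
    proof (cases "comm_group (G\<lparr>carrier := B\<rparr>)")
      case False
      then have "\<not> (\<forall>x\<in>B. \<forall>y\<in>B. x \<otimes>\<^bsub>G\<^esub> y = y \<otimes>\<^bsub>G\<^esub> x)"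
        using group.group_comm_groupI[OF subgroup_imp_group[OF subgroups(2)]] by auto
      then obtain x y where xy: "x \<in> B" "y \<in> B" "x \<otimes>\<^bsub>G\<^esub> y \<noteq> y \<otimes>\<^bsub>G\<^esub> x"
        by blast
      show ?thesis
      \<comment> \<open>If \<open>C\<close> is central in \<open>B\<close>, any noncommuting pair
        serves. Otherwise some \<open>d\<close> in \<open>C\<close> is not central in
        \<open>B\<close>, and it centralises \<open>C\<close> because \<open>C\<close> is
        cyclic.\<close>
      proof (cases "\<forall>d\<in>C. \<forall>b\<in>B. d \<otimes>\<^bsub>G\<^esub> b = b \<otimes>\<^bsub>G\<^esub> d")
        case True
        have "x \<otimes>\<^bsub>G\<^esub> d = d \<otimes>\<^bsub>G\<^esub> x" if "d \<in> C" for d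
          by (rule True[rule_format, OF that xy(1), symmetric])
        then show ?thesis
          using separating_conjugation[OF xy(1) _ xy(2,3)] by simp
      next
        case False
        then obtain d b where "d \<in> C" "b \<in> B" "d \<otimes>\<^bsub>G\<^esub> b \<noteq> b \<otimes>\<^bsub>G\<^esub> d"
          by blast
        then show ?thesis
          using separating_conjugation[of d b] C_comm subgroups(5) by blast
      qed
    next
      case True
      then interpret B: comm_group "G\<lparr>carrier := B\<rparr>" .
      have comm: "b \<otimes>\<^bsub>G\<^esub> b' = b' \<otimes>\<^bsub>G\<^esub> b" if "b \<in> B" "b' \<in> B" for b b'
        using B.m_comm that by simp
      obtain h :: "'a \<Rightarrow> int" where h_hom: "h \<in> hom (G\<lparr>carrier := B\<rparr>) integer_group" and "h ` B = UNIV"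
        using Babel True unfolding surj_onto_Z_def by auto
      then have h: "\<And>b b'. b \<in> B \<Longrightarrow> b' \<in> B \<Longrightarrow> h (b \<otimes>\<^bsub>G\<^esub> b') = h b + h b'" and surj: "1 \<in> h ` B"
        by (auto simp: hom_def)
      obtain t where t: "t \<in> B" "h t = 1"
        using surj by force
      interpret hB: group_hom "G\<lparr>carrier := B\<rparr>" integer_group h
        by (intro group_hom.intro group_hom_axioms.intro B.is_group group_integer_group h_hom)
      have hC: "h c dvd h d" if "d \<in> C" for d
      proof -
        obtain n :: int where "d = c [^]\<^bsub>G\<^esub> n"
          using C_pow \<open>d \<in> C\<close> by blast
        moreover have "c \<in> B"
          using cC subgroups(5) by blast
        ultimately show ?thesis
          using hB.hom_int_pow[of c n] int_pow_consistent[OF subgroups(2), of c n] by simp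
      qed
      \<comment> \<open>The modulus must exceed 1 and divide \<open>h c\<close>: 2 serves when
        \<open>h c = 0\<close>, and \<open>\<bar>h c\<bar>\<close> when it exceeds 1. For
        \<open>h c = -1\<close> the sign of \<open>h\<close> is changed to reduce to the direct
        factor case.\<close>
      consider "h c = 0" | "h c = 1" | "h c = -1" | "1 < \<bar>h c\<bar>"
        by linarith
      then show ?thesis
      proof cases
        case 1
        then have "2 dvd h d" if "d \<in> C" for d
          using hC[OF that] by simp
        then show ?thesis
          using separating_partial_conjugation[OF roots comm h _ t, of 2] by simp
      next
        case 2
        then show ?thesis
          using separating_inversion[OF roots comm cC c(2) CB h] by simp
      next
        case 3
        then show ?thesis
          using separating_inversion[OF roots comm cC c(2) CB, of "\<lambda>b. - h b"] h by simp
      next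
        case 4
        have "\<bar>h c\<bar> dvd h d" if "d \<in> C" for d
          using hC[OF that] by simp
        then show ?thesis
          using separating_partial_conjugation[OF roots comm h _ t 4] by simp
      qed
    qed
  qed
qed

end
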